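(* Let $\pi: X\to\mathbb{P}^2$ be a degree $d$ cyclic covering over $\mathbb{C}$ branched over a Fermat curve of degree $dk$. Then $X$ supports an Ulrich line bundle, i.e. there is a line bundle $E$ on $X$ with $\pi_*E\cong\mathcal{O}_{\mathbb{P}^2}^{\oplus d}$.
   Context: Everything is over $\mathbb{C}$; $d,k$ are positive integers. Cyclic covering of $\mathbb{P}^2$: given $f\in H^0(\mathbb{P}^2,\mathcal{O}_{\mathbb{P}^2}(dk))$ with zero locus $B$, let $p: V\to\mathbb{P}^2$ be the total space of $\mathcal{O}_{\mathbb{P}^2}(k)$ and $T$ the tautological section of $p^*\mathcal{O}_{\mathbb{P}^2}(k)$; the cyclic covering of degree $d$ with branch divisor $B$ is $X=\operatorname{Zero}(T^d-p^*f)\subset V$ with $\pi=p|_X$. A Fermat curve of degree $dk$ is (up to projective equivalence) the plane curve $x^{dk}+y^{dk}-z^{dk}=0$. An Ulrich bundle for $\pi$ is a vector bundle $E$ on $X$ with $\pi_*E\cong\mathcal{O}_{\mathbb{P}^2}^{\oplus\operatorname{rk}(E)\cdot d}$. *)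

theory Defs
  imports "HOL-Analysis.Analysis" "HOL-Algebra.Module"
begin

section \<open>Varieties as spaces with regular functions\<close>

text \<open>
  A complex variety is given by its closed points, its Zariski topology and, for every open set
  \<open>U\<close>, the ring of regular functions \<open>U \<rightarrow> \<complex>\<close>.  Functions on \<open>U\<close> are \<open>undefined\<close> outside
  \<open>U\<close>, so that a function is determined by its values on \<open>U\<close>.
  This language sees only reduced schemes.  Nothing is lost here: the projective plane and the total
  space of a line bundle on it are smooth, and \<open>T ^ d - f\<close> with \<open>f \<noteq> 0\<close> and \<open>d > 0\<close> is
  squarefree.
\<close>

record 'p variety =
  zar :: "'p topology"
  reg :: "'p set \<Rightarrow> ('p \<Rightarrow> complex) set"

definition reg_ring :: "'p variety \<Rightarrow> 'p set \<Rightarrow> ('p \<Rightarrow> complex) ring" where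
  "reg_ring X U = \<lparr> carrier = reg X U,
     mult = (\<lambda>a b. \<lambda>x\<in>U. a x * b x), one = (\<lambda>x\<in>U. 1),
     zero = (\<lambda>x\<in>U. 0), add = (\<lambda>a b. \<lambda>x\<in>U. a x + b x) \<rparr>"

definition closed_subvariety :: "'p variety \<Rightarrow> 'p set \<Rightarrow> 'p variety" where
  "closed_subvariety Y Z = \<lparr> zar = subtopology (zar Y) Z,
     reg = (\<lambda>U. {\<phi> \<in> extensional U. \<forall>x\<in>U. \<exists>W \<psi>. openin (zar Y) W \<and> x \<in> W \<and> \<psi> \<in> reg Y W \<and>
                     (\<forall>y\<in>W \<inter> U. \<phi> y = \<psi> y)}) \<rparr>"


section \<open>Quotients of cones by the multiplicative group\<close>

text \<open>
  Let the multiplicative group act on a cone \<open>C\<close>, and let \<open>S m\<close> be the functions on \<open>C\<close> that are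
  homogeneous of degree \<open>m\<close> in a graded coordinate ring \<open>S\<close>.  The points of the quotient are the
  orbits, the nonvanishing loci of homogeneous elements form a basis of the topology, and the regular
  functions are locally fractions of two homogeneous elements of the same degree.
\<close>

definition orbit :: "(complex \<Rightarrow> 'c \<Rightarrow> 'c) \<Rightarrow> 'c \<Rightarrow> 'c set" where
  "orbit act c = {act l c | l. l \<noteq> 0}"

definition zero_locus :: "'c set \<Rightarrow> (complex \<Rightarrow> 'c \<Rightarrow> 'c) \<Rightarrow> ('c \<Rightarrow> complex) \<Rightarrow> 'c set set" where
  "zero_locus C act F = {orbit act c | c. c \<in> C \<and> F c = 0}"

definition nonzero_locus :: "'c set \<Rightarrow> (complex \<Rightarrow> 'c \<Rightarrow> 'c) \<Rightarrow> ('c \<Rightarrow> complex) \<Rightarrow> 'c set set" where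
  "nonzero_locus C act F = {orbit act c | c. c \<in> C \<and> F c \<noteq> 0}"

definition cone_topology ::
    "'c set \<Rightarrow> (complex \<Rightarrow> 'c \<Rightarrow> 'c) \<Rightarrow> (nat \<Rightarrow> ('c \<Rightarrow> complex) set) \<Rightarrow> 'c set topology" where
  "cone_topology C act S = topology_generated_by {nonzero_locus C act F | F m. F \<in> S m}"

definition cone_quotient ::
    "'c set \<Rightarrow> (complex \<Rightarrow> 'c \<Rightarrow> 'c) \<Rightarrow> (nat \<Rightarrow> ('c \<Rightarrow> complex) set) \<Rightarrow> 'c set variety" where
  "cone_quotient C act S = \<lparr> zar = cone_topology C act S,
     reg = (\<lambda>U. {\<phi> \<in> extensional U. \<forall>x\<in>U. \<exists>W m. openin (cone_topology C act S) W \<and> x \<in> W \<and> W \<subseteq> U \<and>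
              (\<exists>a\<in>S m. \<exists>b\<in>S m. \<forall>c\<in>C. orbit act c \<in> W \<longrightarrow>
                 b c \<noteq> 0 \<and> \<phi> (orbit act c) = a c / b c)}) \<rparr>"


section \<open>The projective plane and its line bundles\<close>

text \<open>Forms of degree \<open>m\<close> in three variables, i.e. the space of global sections of \<open>O(m)\<close>.\<close>

definition forms :: "nat \<Rightarrow> (complex^3 \<Rightarrow> complex) set" where
  "forms m = {h. \<exists>a :: nat \<Rightarrow> nat \<Rightarrow> complex.
     h = (\<lambda>v. \<Sum>i\<le>m. \<Sum>j\<le>m - i. a i j * (v$1)^i * (v$2)^j * (v$3)^(m - i - j))}"

abbreviation plane_cone :: "(complex^3) set" where
  "plane_cone \<equiv> {v. v \<noteq> 0}"

definition proj_plane :: "(complex^3) set variety" where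
  "proj_plane = cone_quotient plane_cone (*s) forms"

text \<open>
  The total space of \<open>O(k)\<close> is the quotient of the pairs \<open>(v, t)\<close> with \<open>v \<noteq> 0\<close> by
  \<open>l \<cdot> (v, t) = (l v, l ^ k t)\<close>.  A form \<open>h\<close> of degree \<open>k\<close> corresponds to the section
  \<open>[v] \<mapsto> [v, h v]\<close>.  The coordinate \<open>t\<close> has weight \<open>k\<close>; it is the tautological section of the
  pullback of \<open>O(k)\<close>.
\<close>

definition bundle_act :: "nat \<Rightarrow> complex \<Rightarrow> (complex^3) \<times> complex \<Rightarrow> (complex^3) \<times> complex" where
  "bundle_act k l = (\<lambda>(v, t). (l *s v, l ^ k * t))"

abbreviation bundle_cone :: "((complex^3) \<times> complex) set" where
  "bundle_cone \<equiv> {(v, t). v \<noteq> 0}"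

definition bundle_forms :: "nat \<Rightarrow> nat \<Rightarrow> ((complex^3) \<times> complex \<Rightarrow> complex) set" where
  "bundle_forms k m = {F. \<exists>h. (\<forall>j\<le>m div k. h j \<in> forms (m - k * j)) \<and>
     F = (\<lambda>(v, t). \<Sum>j\<le>m div k. h j v * t ^ j)}"

definition total_space :: "nat \<Rightarrow> ((complex^3) \<times> complex) set variety" where
  "total_space k = cone_quotient bundle_cone (bundle_act k) (bundle_forms k)"

text \<open>The image of the orbit of \<open>(v, t)\<close> under \<open>fst\<close> is the orbit of \<open>v\<close>.\<close>

definition bundle_proj :: "((complex^3) \<times> complex) set \<Rightarrow> (complex^3) set" where
  "bundle_proj x = fst ` x"

text \<open>The covering map is the restriction of \<open>bundle_proj\<close>.\<close>

definition cyclic_cover ::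
    "nat \<Rightarrow> nat \<Rightarrow> (complex^3 \<Rightarrow> complex) \<Rightarrow> ((complex^3) \<times> complex) set variety" where
  "cyclic_cover d k f = closed_subvariety (total_space k)
     (zero_locus bundle_cone (bundle_act k) (\<lambda>(v, t). t ^ d - f v))"

text \<open>
  Curves are given by their sets of points.  A form of degree \<open>n > 0\<close> whose zero set is a Fermat curve
  of degree \<open>n\<close> is automatically a nonzero multiple of a linear transform of the Fermat form, since
  the latter is squarefree of the same degree.  So the branch divisor is the Fermat curve as a divisor,
  too.
\<close>

definition fermat_curve :: "nat \<Rightarrow> (complex^3) set set \<Rightarrow> bool" where
  "fermat_curve n B \<longleftrightarrow> (\<exists>A :: complex^3^3. invertible A \<and>
     B = (\<lambda>x. (*v) A ` x) ` zero_locus plane_cone (*s) (\<lambda>v. (v$1)^n + (v$2)^n - (v$3)^n))"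


section \<open>Sheaves of modules and vector bundles\<close>

record ('p, 'm) sheaf =
  sec :: "'p set \<Rightarrow> ('p \<Rightarrow> complex, 'm) module"
  res :: "'p set \<Rightarrow> 'p set \<Rightarrow> 'm \<Rightarrow> 'm"

locale module_sheaf =
  fixes X :: "'p variety" and M :: "('p, 'm) sheaf"
  assumes module: "openin (zar X) U \<Longrightarrow> Module.module (reg_ring X U) (sec M U)"
    and res_closed: "\<lbrakk> openin (zar X) U; openin (zar X) V; V \<subseteq> U; s \<in> carrier (sec M U) \<rbrakk>
      \<Longrightarrow> res M U V s \<in> carrier (sec M V)"
    and res_add: "\<lbrakk> openin (zar X) U; openin (zar X) V; V \<subseteq> U;
        s \<in> carrier (sec M U); t \<in> carrier (sec M U) \<rbrakk>
      \<Longrightarrow> res M U V (s \<oplus>\<^bsub>sec M U\<^esub> t) = res M U V s \<oplus>\<^bsub>sec M V\<^esub> res M U V t"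
    and res_smult: "\<lbrakk> openin (zar X) U; openin (zar X) V; V \<subseteq> U;
        a \<in> reg X U; s \<in> carrier (sec M U) \<rbrakk>
      \<Longrightarrow> res M U V (a \<odot>\<^bsub>sec M U\<^esub> s) = restrict a V \<odot>\<^bsub>sec M V\<^esub> res M U V s"
    and res_id: "\<lbrakk> openin (zar X) U; s \<in> carrier (sec M U) \<rbrakk> \<Longrightarrow> res M U U s = s"
    and res_res: "\<lbrakk> openin (zar X) U; openin (zar X) V; openin (zar X) W; W \<subseteq> V; V \<subseteq> U;
        s \<in> carrier (sec M U) \<rbrakk> \<Longrightarrow> res M V W (res M U V s) = res M U W s"
    and locality: "\<lbrakk> \<forall>V\<in>\<U>. openin (zar X) V; s \<in> carrier (sec M (\<Union>\<U>)); t \<in> carrier (sec M (\<Union>\<U>));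
        \<forall>V\<in>\<U>. res M (\<Union>\<U>) V s = res M (\<Union>\<U>) V t \<rbrakk> \<Longrightarrow> s = t"
    and gluing: "\<lbrakk> \<forall>V\<in>\<U>. openin (zar X) V; \<forall>V\<in>\<U>. g V \<in> carrier (sec M V);
        \<forall>V\<in>\<U>. \<forall>W\<in>\<U>. res M V (V \<inter> W) (g V) = res M W (V \<inter> W) (g W) \<rbrakk>
      \<Longrightarrow> \<exists>s\<in>carrier (sec M (\<Union>\<U>)). \<forall>V\<in>\<U>. res M (\<Union>\<U>) V s = g V"

text \<open>Isomorphism of the restrictions of two sheaves of modules to an open set \<open>W\<close>.\<close>

definition isomorphic_over ::
    "'p variety \<Rightarrow> 'p set \<Rightarrow> ('p, 'm) sheaf \<Rightarrow> ('p, 'n) sheaf \<Rightarrow> bool" where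
  "isomorphic_over X W M N \<longleftrightarrow> (\<exists>\<phi> :: 'p set \<Rightarrow> 'm \<Rightarrow> 'n.
     (\<forall>U. openin (zar X) U \<and> U \<subseteq> W \<longrightarrow>
        bij_betw (\<phi> U) (carrier (sec M U)) (carrier (sec N U)) \<and>
        (\<forall>s\<in>carrier (sec M U). \<forall>t\<in>carrier (sec M U).
           \<phi> U (s \<oplus>\<^bsub>sec M U\<^esub> t) = \<phi> U s \<oplus>\<^bsub>sec N U\<^esub> \<phi> U t) \<and>
        (\<forall>a\<in>reg X U. \<forall>s\<in>carrier (sec M U). \<phi> U (a \<odot>\<^bsub>sec M U\<^esub> s) = a \<odot>\<^bsub>sec N U\<^esub> \<phi> U s)) \<and>
     (\<forall>U V. openin (zar X) U \<and> openin (zar X) V \<and> V \<subseteq> U \<and> U \<subseteq> W \<longrightarrow>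
        (\<forall>s\<in>carrier (sec M U). \<phi> V (res M U V s) = res N U V (\<phi> U s))))"

abbreviation isomorphic :: "'p variety \<Rightarrow> ('p, 'm) sheaf \<Rightarrow> ('p, 'n) sheaf \<Rightarrow> bool" where
  "isomorphic X \<equiv> isomorphic_over X (topspace (zar X))"

text \<open>
  The free sheaf of rank \<open>r\<close>.  The fields \<open>mult\<close> and \<open>one\<close> are inherited from rings and play no role
  in modules.
\<close>

definition free_sheaf :: "'p variety \<Rightarrow> nat \<Rightarrow> ('p, nat \<Rightarrow> 'p \<Rightarrow> complex) sheaf" where
  "free_sheaf X r = \<lparr>
     sec = (\<lambda>U. \<lparr> carrier = {..<r} \<rightarrow>\<^sub>E reg X U, mult = undefined, one = undefined,
        zero = (\<lambda>i\<in>{..<r}. \<zero>\<^bsub>reg_ring X U\<^esub>),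
        add = (\<lambda>s t. \<lambda>i\<in>{..<r}. s i \<oplus>\<^bsub>reg_ring X U\<^esub> t i),
        smult = (\<lambda>a s. \<lambda>i\<in>{..<r}. a \<otimes>\<^bsub>reg_ring X U\<^esub> s i) \<rparr>),
     res = (\<lambda>U V s. \<lambda>i\<in>{..<r}. restrict (s i) V) \<rparr>"

definition vector_bundle :: "'p variety \<Rightarrow> nat \<Rightarrow> ('p, 'm) sheaf \<Rightarrow> bool" where
  "vector_bundle X r E \<longleftrightarrow> module_sheaf X E \<and>
     (\<forall>x\<in>topspace (zar X). \<exists>W. openin (zar X) W \<and> x \<in> W \<and> isomorphic_over X W E (free_sheaf X r))"

definition direct_image ::
    "'p variety \<Rightarrow> ('p \<Rightarrow> 'q) \<Rightarrow> ('p, 'm) sheaf \<Rightarrow> ('q, 'm) sheaf" where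
  "direct_image X \<pi> E = (let pre = (\<lambda>U. {x \<in> topspace (zar X). \<pi> x \<in> U}) in \<lparr>
     sec = (\<lambda>U. \<lparr> carrier = carrier (sec E (pre U)),
        mult = mult (sec E (pre U)), one = one (sec E (pre U)),
        zero = zero (sec E (pre U)), add = add (sec E (pre U)),
        smult = (\<lambda>a s. (\<lambda>x\<in>pre U. a (\<pi> x)) \<odot>\<^bsub>sec E (pre U)\<^esub> s) \<rparr>),
     res = (\<lambda>U V. res E (pre U) (pre V)) \<rparr>)"

text \<open>Ulrich bundles of rank \<open>r\<close> for a covering \<open>\<pi> : X \<rightarrow> Y\<close> of degree \<open>d\<close>.\<close>

definition ulrich_bundle ::
    "'p variety \<Rightarrow> 'q variety \<Rightarrow> ('p \<Rightarrow> 'q) \<Rightarrow> nat \<Rightarrow> nat \<Rightarrow> ('p, 'm) sheaf \<Rightarrow> bool" where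
  "ulrich_bundle X Y \<pi> d r E \<longleftrightarrow>
     vector_bundle X r E \<and> isomorphic Y (direct_image X \<pi> E) (free_sheaf Y (r * d))"

text \<open>
  Existence of a bundle is stated for sheaves with sections of a fixed type, as HOL has no
  quantification over types.  On a variety \<open>X\<close> with points of type \<open>'p\<close> the type
  \<open>nat \<Rightarrow> 'p \<Rightarrow> complex\<close> is no restriction: choosing a basis in every fibre, one describes the
  sections of a bundle of rank \<open>r\<close> over \<open>U\<close> by \<open>r\<close>-tuples of (not necessarily regular)
  functions on \<open>U\<close>.
\<close>

type_synonym 'p fun_sheaf = "('p, nat \<Rightarrow> 'p \<Rightarrow> complex) sheaf"

end

theory Submission
  imports Defs
begin

text \<open>
  After a linear change of coordinates the covering is \<open>t ^ d + Z ^ d = X ^ d + Y ^ d\<close> with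
  \<open>X, Y, Z\<close> the \<open>k\<close>-th powers of coordinates.  Both sides split into \<open>d\<close> factors
  \<open>l\<^sub>i = t - \<mu>\<^sub>i Z\<close> and \<open>g\<^sub>i = X - \<mu>\<^sub>i Y\<close>, where \<open>\<mu>\<^sub>i\<close> runs through the \<open>d\<close>-th roots of \<open>-1\<close>.
  The cyclic system \<open>l\<^sub>i u\<^sub>i = g\<^sub>i u\<^bsub>i-1\<^esub>\<close> has the form \<open>t u = M u\<close> for a matrix \<open>M\<close> of forms on the
  plane whose characteristic polynomial in \<open>t\<close> is the equation of the covering.  Two of the \<open>l\<^sub>i\<close> vanish
  together only where at most one \<open>g\<^sub>i\<close> vanishes, so the solutions form a line at every point, and
  they are the sections of a line bundle.  A vector \<open>u\<close> of polynomials in \<open>t\<close> of degree below \<open>d\<close>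
  that solves the system is determined by its coefficients of \<open>t ^ (d - 1)\<close>, which can be prescribed
  arbitrarily; this trivialises the direct image.
\<close>

section \<open>Graded rings of functions on a cone\<close>

text \<open>Degrees dictate the twist by \<open>k (d - 1)\<close>. Locally, after clearing
  denominators and reducing modulo the equation of the covering, the coefficient of
  \<open>t ^ r\<close> in an entry of \<open>u\<close> has degree \<open>k (d - 1) - k r\<close>;
  exactly the one of \<open>t ^ (d - 1)\<close> has degree zero, and the \<open>d\<close> entries of
  \<open>u\<close> give \<open>d\<close> functions on the plane. Conversely, the columns of the
  adjugate of \<open>t - M\<close> are solutions, and the coefficient matrix of
  \<open>t ^ (d - 1)\<close> in the adjugate is the identity; so combining the columns inverts the
  reading of top coefficients.

  Two obstacles shape the proof. A section over the preimage of an open set is only a local fraction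
  whose denominator involves \<open>t\<close>; norms turn such denominators into forms on the plane.
  Moreover, the fibre over a branch point is the single point \<open>t = 0\<close>, so a polynomial
  in \<open>t\<close> is not determined by its values there. Polynomials in \<open>t\<close> are
  therefore compared only where \<open>f\<close> is nonzero, and the result reaches the branch curve
  as an identity between forms on the plane, which have no zero divisors.\<close>

locale graded_ring =
  fixes S :: "nat \<Rightarrow> ('c \<Rightarrow> complex) set"
  assumes const: "(\<lambda>_. z) \<in> S 0"
    and add: "a \<in> S m \<Longrightarrow> b \<in> S m \<Longrightarrow> (\<lambda>c. a c + b c) \<in> S m"
    and mult: "a \<in> S m \<Longrightarrow> b \<in> S n \<Longrightarrow> (\<lambda>c. a c * b c) \<in> S (m + n)"
    and zero: "(\<lambda>_. 0) \<in> S m"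
begin

lemma scale: "a \<in> S m \<Longrightarrow> (\<lambda>c. z * a c) \<in> S m"
  using mult[OF const] by fastforce

lemma diff: "a \<in> S m \<Longrightarrow> b \<in> S m \<Longrightarrow> (\<lambda>c. a c - b c) \<in> S m"
  using add[OF _ scale[of b m "-1"]] by force

lemma pow: "a \<in> S m \<Longrightarrow> (\<lambda>c. a c ^ n) \<in> S (m * n)"
proof (induction n)
  case 0
  then show ?case using const[of 1] by simp
next
  case (Suc n)
  then show ?case using mult[OF Suc.prems Suc.IH] by simp
qed

lemma sum: "(\<And>i. i \<in> I \<Longrightarrow> a i \<in> S m) \<Longrightarrow> (\<lambda>c. \<Sum>i\<in>I. a i c) \<in> S m"
  by (induction I rule: infinite_finite_induct) (auto simp: zero add)

lemma prod: "finite I \<Longrightarrow> (\<And>i. i \<in> I \<Longrightarrow> a i \<in> S m) \<Longrightarrow> (\<lambda>c. \<Prod>i\<in>I. a i c) \<in> S (m * card I)"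
proof (induction I rule: finite_induct)
  case empty
  then show ?case using const[of 1] by simp
next
  case (insert x F)
  have "(\<lambda>c. a x c * (\<Prod>i\<in>F. a i c)) \<in> S (m + m * card F)"
    by (intro mult insert) (auto intro: insert)
  then show ?case using insert by simp
qed

end

text \<open>A form is not a function on orbits, so it is evaluated at a chosen representative
  \<open>R p\<close>. By homogeneity neither its vanishing there nor the ratio of two forms of equal
  degree depends on the choice.\<close>

locale graded_cone = graded_ring S
  for S :: "nat \<Rightarrow> ('c \<Rightarrow> complex) set" +
  fixes C :: "'c set" and act :: "complex \<Rightarrow> 'c \<Rightarrow> 'c" and R :: "'c set \<Rightarrow> 'c"
  assumes act_one: "act 1 c = c"
    and act_act: "act l (act l' c) = act (l * l') c"
    and homogeneous: "a \<in> S m \<Longrightarrow> a (act l c) = l ^ m * a c"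
    and R_cone: "c \<in> C \<Longrightarrow> R (orbit act c) \<in> C"
    and R_orbit: "c \<in> C \<Longrightarrow> R (orbit act c) \<in> orbit act c"
begin

definition points :: "'c set set" where "points = orbit act ` C"

lemma orbit_eq: "c' \<in> orbit act c \<Longrightarrow> orbit act c' = orbit act c"
proof -
  assume "c' \<in> orbit act c"
  then obtain l where l: "l \<noteq> 0" "c' = act l c" by (auto simp: orbit_def)
  have m: "act m c = act (m / l) c'" for m using l by (simp add: act_act)
  have "orbit act c \<subseteq> orbit act c'"
  proof
    fix x assume "x \<in> orbit act c"
    then obtain n where "n \<noteq> 0" "x = act n c" by (auto simp: orbit_def)
    then show "x \<in> orbit act c'" using m[of n] l unfolding orbit_def
      by (auto intro!: exI[of _ "n / l"])
  qed
  moreover have "orbit act c' \<subseteq> orbit act c"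
  proof
    fix x assume "x \<in> orbit act c'"
    then obtain n where "n \<noteq> 0" "x = act n c'" by (auto simp: orbit_def)
    then have "x = act (n * l) c" "n * l \<noteq> 0" using l act_act by auto
    then show "x \<in> orbit act c" unfolding orbit_def by blast
  qed
  ultimately show ?thesis by blast
qed

lemma orbit_refl: "c \<in> orbit act c"
  unfolding orbit_def by (auto intro!: exI[of _ 1] simp: act_one)

lemma orbit_R: "p \<in> points \<Longrightarrow> orbit act (R p) = p"
  using R_orbit orbit_eq by (auto simp: points_def)

lemma R_in: "p \<in> points \<Longrightarrow> R p \<in> C"
  using R_cone by (auto simp: points_def)

lemma orbit_in_points: "c \<in> C \<Longrightarrow> orbit act c \<in> points"
  by (simp add: points_def)

lemma R_act: "c \<in> C \<Longrightarrow> \<exists>l. l \<noteq> 0 \<and> c = act l (R (orbit act c))"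
proof -
  assume c: "c \<in> C"
  then have "orbit act (R (orbit act c)) = orbit act c"
    using R_orbit orbit_eq by auto
  then have "c \<in> orbit act (R (orbit act c))" using orbit_refl by simp
  then show ?thesis by (auto simp: orbit_def)
qed

lemma nonzero_locus_eq:
  assumes "a \<in> S m"
  shows "nonzero_locus C act a = {p \<in> points. a (R p) \<noteq> 0}"
proof (intro equalityI subsetI)
  fix p assume "p \<in> nonzero_locus C act a"
  then obtain c where c: "c \<in> C" "a c \<noteq> 0" "p = orbit act c" by (auto simp: nonzero_locus_def)
  from R_act[OF c(1)] obtain l where "c = act l (R p)" using c by auto
  then have "a c = l ^ m * a (R p)" using homogeneous[OF assms] by metis
  then have "a (R p) \<noteq> 0" using c by auto
  then show "p \<in> {p \<in> points. a (R p) \<noteq> 0}" using c by (auto simp: points_def)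
next
  fix p assume "p \<in> {p \<in> points. a (R p) \<noteq> 0}"
  then show "p \<in> nonzero_locus C act a"
    using orbit_R R_in by (force simp: nonzero_locus_def)
qed

lemma zero_locus_eq:
  assumes "a \<in> S m"
  shows "zero_locus C act a = {p \<in> points. a (R p) = 0}"
proof (intro equalityI subsetI)
  fix p assume "p \<in> zero_locus C act a"
  then obtain c where c: "c \<in> C" "a c = 0" "p = orbit act c" by (auto simp: zero_locus_def)
  from R_act[OF c(1)] obtain l where l: "l \<noteq> 0" "c = act l (R p)" using c(3) by blast
  then have "a c = l ^ m * a (R p)" using homogeneous[OF assms] by metis
  then have "a (R p) = 0" using c(2) l(1) by simp
  then show "p \<in> {p \<in> points. a (R p) = 0}" using c by (auto simp: points_def)
next
  fix p assume "p \<in> {p \<in> points. a (R p) = 0}"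
  then show "p \<in> zero_locus C act a"
    using orbit_R[of p] R_in[of p] unfolding zero_locus_def by auto
qed

abbreviation "ztop \<equiv> cone_topology C act S"

lemma openin_basic: "a \<in> S m \<Longrightarrow> openin ztop {p \<in> points. a (R p) \<noteq> 0}"
  unfolding cone_topology_def
  by (rule topology_generated_by_Basis) (use nonzero_locus_eq in blast)

text \<open>The nonvanishing loci are a basis and not just a subbasis, because the locus of a
  product of forms is the intersection of their loci.\<close>

lemma openin_cone_topology:
  "openin ztop U \<longleftrightarrow> U \<subseteq> points \<and>
     (\<forall>p\<in>U. \<exists>m. \<exists>g\<in>S m. g (R p) \<noteq> 0 \<and> (\<forall>q\<in>points. g (R q) \<noteq> 0 \<longrightarrow> q \<in> U))"
    (is "_ \<longleftrightarrow> ?P U")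
proof
  assume "openin ztop U"
  then have "generate_topology_on {nonzero_locus C act F | F m. F \<in> S m} U"
    by (simp add: cone_topology_def openin_topology_generated_by_iff)
  then show "?P U"
  proof induction
    case Empty
    then show ?case by simp
  next
    case (Int U V)
    show ?case
    proof (intro conjI ballI)
      show "U \<inter> V \<subseteq> points" using Int by auto
      fix p assume p: "p \<in> U \<inter> V"
      obtain m g where g: "g \<in> S m" "g (R p) \<noteq> 0" "\<forall>q\<in>points. g (R q) \<noteq> 0 \<longrightarrow> q \<in> U"
        using Int p by blast
      obtain n h where h: "h \<in> S n" "h (R p) \<noteq> 0" "\<forall>q\<in>points. h (R q) \<noteq> 0 \<longrightarrow> q \<in> V"
        using Int p by blast
      show "\<exists>m. \<exists>g\<in>S m. g (R p) \<noteq> 0 \<and> (\<forall>q\<in>points. g (R q) \<noteq> 0 \<longrightarrow> q \<in> U \<inter> V)"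
        by (rule exI, rule bexI[OF _ mult[OF g(1) h(1)]]) (use g h in auto)
    qed
  next
    case (UN K)
    show ?case
    proof (intro conjI ballI)
      show "\<Union>K \<subseteq> points" using UN by blast
      fix p assume "p \<in> \<Union>K"
      then obtain V where V: "V \<in> K" "p \<in> V" by blast
      then obtain m g where g: "g \<in> S m" "g (R p) \<noteq> 0" "\<forall>q\<in>points. g (R q) \<noteq> 0 \<longrightarrow> q \<in> V"
        using UN by blast
      then show "\<exists>m. \<exists>g\<in>S m. g (R p) \<noteq> 0 \<and> (\<forall>q\<in>points. g (R q) \<noteq> 0 \<longrightarrow> q \<in> \<Union>K)"
        using V by blast
    qed
  next
    case (Basis s)
    then obtain F m where "F \<in> S m" "s = {p \<in> points. F (R p) \<noteq> 0}"
      using nonzero_locus_eq by auto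
    then show ?case by blast
  qed
next
  assume U: "?P U"
  show "openin ztop U"
  proof (subst openin_subopen, intro ballI)
    fix p assume p: "p \<in> U"
    with U obtain m g where g: "g \<in> S m" "g (R p) \<noteq> 0" "\<forall>q\<in>points. g (R q) \<noteq> 0 \<longrightarrow> q \<in> U"
      by blast
    show "\<exists>T. openin ztop T \<and> p \<in> T \<and> T \<subseteq> U"
      by (rule exI[of _ "{p \<in> points. g (R p) \<noteq> 0}"]) (use openin_basic[OF g(1)] g U p in auto)
  qed
qed

lemma topspace_cone: "topspace ztop = points"
proof
  show "topspace ztop \<subseteq> points" using openin_cone_topology by auto
  have "openin ztop points"
    unfolding openin_cone_topology using const[of 1] by (auto intro!: exI[of _ 0] bexI[of _ "\<lambda>_. 1"])
  then show "points \<subseteq> topspace ztop" by (rule openin_subset)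
qed

text \<open>
  Sections of the \<open>N\<close>-th twist are evaluated at the chosen representatives of the orbits.  The
  local fraction \<open>a / b\<close> may be required on all of \<open>U\<close> in the form \<open>s b = a\<close>: multiply both \<open>a\<close>
  and \<open>b\<close> by a form that vanishes where the fraction is not valid.
\<close>

definition locfrac :: "nat \<Rightarrow> 'c set set \<Rightarrow> (nat \<Rightarrow> 'c set \<Rightarrow> complex) \<Rightarrow> bool" where
  "locfrac N U s \<longleftrightarrow> (\<forall>p\<in>U. \<exists>m. \<exists>b\<in>S m. b (R p) \<noteq> 0 \<and>
     (\<forall>i. \<exists>a\<in>S (m + N). \<forall>q\<in>U. s i q * b (R q) = a (R q)))"

section \<open>Calculus of local fractions\<close>

lemma locfracE:
  assumes "locfrac N U s" "p \<in> U"
  obtains m b a where "b \<in> S m" "b (R p) \<noteq> 0" "\<And>i. a i \<in> S (m + N)"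
    "\<And>i q. q \<in> U \<Longrightarrow> s i q * b (R q) = a i (R q)"
proof -
  obtain m b where b: "b \<in> S m" "b (R p) \<noteq> 0"
     "\<forall>i. \<exists>a\<in>S (m + N). \<forall>q\<in>U. s i q * b (R q) = a (R q)"
    using assms by (auto simp: locfrac_def)
  from b(3) obtain a where "\<forall>i. a i \<in> S (m + N) \<and> (\<forall>q\<in>U. s i q * b (R q) = a i (R q))"
    by metis
  then show thesis using that b by blast
qed

lemma locfracI:
  assumes "\<And>p. p \<in> U \<Longrightarrow> \<exists>m b a. b \<in> S m \<and> b (R p) \<noteq> 0 \<and> (\<forall>i. a i \<in> S (m + N)) \<and>
    (\<forall>i. \<forall>q\<in>U. s i q * b (R q) = a i (R q))"
  shows "locfrac N U s"
  unfolding locfrac_def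
proof
  fix p assume "p \<in> U"
  from assms[OF this] obtain m b a where "b \<in> S m" "b (R p) \<noteq> 0" "\<forall>i. a i \<in> S (m + N)"
    "\<forall>i. \<forall>q\<in>U. s i q * b (R q) = a i (R q)" by blast
  then show "\<exists>m. \<exists>b\<in>S m. b (R p) \<noteq> 0 \<and> (\<forall>i. \<exists>a\<in>S (m + N). \<forall>q\<in>U. s i q * b (R q) = a (R q))"
    by (intro exI[of _ m] bexI[of _ b] conjI allI bexI[of _ "a i" for i]) auto
qed

lemma locfrac_cong: "(\<And>i p. p \<in> U \<Longrightarrow> s i p = t i p) \<Longrightarrow> locfrac N U s = locfrac N U t"
  by (simp add: locfrac_def)

lemma locfrac_subset:
  assumes "locfrac N U s" "V \<subseteq> U"
  shows "locfrac N V s"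
proof (rule locfracI)
  fix p assume "p \<in> V"
  then have "p \<in> U" using assms by blast
  then obtain m b a where "b \<in> S m" "b (R p) \<noteq> 0" "\<And>i. a i \<in> S (m + N)"
    "\<And>i q. q \<in> U \<Longrightarrow> s i q * b (R q) = a i (R q)" using locfracE[OF assms(1)] by metis
  then show "\<exists>m b a. b \<in> S m \<and> b (R p) \<noteq> 0 \<and> (\<forall>i. a i \<in> S (m + N)) \<and>
    (\<forall>i. \<forall>q\<in>V. s i q * b (R q) = a i (R q))"
    using assms(2) by (intro exI[of _ m] exI[of _ b] exI[of _ a]) auto
qed

lemma locfrac_component:
  assumes "locfrac N U s"
  shows "locfrac N U (\<lambda>_. s i0)"
proof (rule locfracI)
  fix p assume "p \<in> U"
  then obtain m b a where "b \<in> S m" "b (R p) \<noteq> 0" "\<And>i. a i \<in> S (m + N)"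
    "\<And>i q. q \<in> U \<Longrightarrow> s i q * b (R q) = a i (R q)" using locfracE[OF assms(1)] by metis
  then show "\<exists>m b a. b \<in> S m \<and> b (R p) \<noteq> 0 \<and> (\<forall>i. a i \<in> S (m + N)) \<and>
    (\<forall>i::nat. \<forall>q\<in>U. s i0 q * b (R q) = a i (R q))"
    by (intro exI[of _ m] exI[of _ b] exI[of _ "\<lambda>_. a i0"]) auto
qed

lemma locfrac_const: "locfrac 0 U (\<lambda>i p. z i)"
  by (rule locfracI, rule exI[of _ 0], rule exI[of _ "\<lambda>_. 1"], rule exI[of _ "\<lambda>i _. z i"])
    (auto simp: const)

lemma locfrac_form: "(\<And>i. a i \<in> S N) \<Longrightarrow> locfrac N U (\<lambda>i p. a i (R p))"
  by (rule locfracI, rule exI[of _ 0], rule exI[of _ "\<lambda>_. 1"], rule exI[of _ a])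
    (auto simp: const)

lemma locfrac_zero: "locfrac N U (\<lambda>i p. 0)"
  using locfrac_form[of "\<lambda>_ _. 0"] zero by simp

lemma locfrac_add:
  assumes "locfrac N U s" "locfrac N U t"
  shows "locfrac N U (\<lambda>i p. s i p + t i p)"
proof (rule locfracI)
  fix p assume p: "p \<in> U"
  obtain m b a where 1: "b \<in> S m" "b (R p) \<noteq> 0" "\<And>i. a i \<in> S (m + N)"
    "\<And>i q. q \<in> U \<Longrightarrow> s i q * b (R q) = a i (R q)" using locfracE[OF assms(1) p] by metis
  obtain m' b' a' where 2: "b' \<in> S m'" "b' (R p) \<noteq> 0" "\<And>i. a' i \<in> S (m' + N)"
    "\<And>i q. q \<in> U \<Longrightarrow> t i q * b' (R q) = a' i (R q)" using locfracE[OF assms(2) p] by metis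
  show "\<exists>m b a. b \<in> S m \<and> b (R p) \<noteq> 0 \<and> (\<forall>i. a i \<in> S (m + N)) \<and>
    (\<forall>i. \<forall>q\<in>U. (s i q + t i q) * b (R q) = a i (R q))"
  proof (intro exI conjI allI ballI)
    show "(\<lambda>c. b c * b' c) \<in> S (m + m')" by (rule mult[OF 1(1) 2(1)])
    show "b (R p) * b' (R p) \<noteq> 0" using 1 2 by simp
    fix i
    have "(\<lambda>c. a i c * b' c) \<in> S (m + m' + N)" "(\<lambda>c. b c * a' i c) \<in> S (m + m' + N)"
      using mult[OF 1(3) 2(1), of i] mult[OF 1(1) 2(3), of i] by (simp_all add: ac_simps)
    then show "(\<lambda>c. a i c * b' c + b c * a' i c) \<in> S (m + m' + N)" by (rule add)
    fix q assume q: "q \<in> U"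
    show "(s i q + t i q) * (b (R q) * b' (R q)) = a i (R q) * b' (R q) + b (R q) * a' i (R q)"
      unfolding 1(4)[OF q, symmetric] 2(4)[OF q, symmetric] by (simp add: algebra_simps)
  qed
qed

lemma locfrac_mult:
  assumes "locfrac N U s" "locfrac N' U t"
  shows "locfrac (N + N') U (\<lambda>i p. s i p * t i p)"
proof (rule locfracI)
  fix p assume p: "p \<in> U"
  obtain m b a where 1: "b \<in> S m" "b (R p) \<noteq> 0" "\<And>i. a i \<in> S (m + N)"
    "\<And>i q. q \<in> U \<Longrightarrow> s i q * b (R q) = a i (R q)" using locfracE[OF assms(1) p] by metis
  obtain m' b' a' where 2: "b' \<in> S m'" "b' (R p) \<noteq> 0" "\<And>i. a' i \<in> S (m' + N')"
    "\<And>i q. q \<in> U \<Longrightarrow> t i q * b' (R q) = a' i (R q)" using locfracE[OF assms(2) p] by metis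
  show "\<exists>m b a. b \<in> S m \<and> b (R p) \<noteq> 0 \<and> (\<forall>i. a i \<in> S (m + (N + N'))) \<and>
    (\<forall>i. \<forall>q\<in>U. (s i q * t i q) * b (R q) = a i (R q))"
  proof (intro exI conjI allI ballI)
    show "(\<lambda>c. b c * b' c) \<in> S (m + m')" by (rule mult[OF 1(1) 2(1)])
    show "b (R p) * b' (R p) \<noteq> 0" using 1 2 by simp
    fix i
    show "(\<lambda>c. a i c * a' i c) \<in> S (m + m' + (N + N'))"
      using mult[OF 1(3) 2(3), of i i] by (simp add: ac_simps)
    fix q assume q: "q \<in> U"
    show "(s i q * t i q) * (b (R q) * b' (R q)) = a i (R q) * a' i (R q)"
      unfolding 1(4)[OF q, symmetric] 2(4)[OF q, symmetric] by (simp add: algebra_simps)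
  qed
qed

lemma locfrac_scale_function:
  assumes "locfrac 0 U (\<lambda>_. a)" "locfrac N U s"
  shows "locfrac N U (\<lambda>i p. a p * s i p)"
  using locfrac_mult[OF assms] by simp

lemma locfrac_sum:
  "(\<And>j. j \<in> J \<Longrightarrow> locfrac N U (s j)) \<Longrightarrow> locfrac N U (\<lambda>i p. \<Sum>j\<in>J. s j i p)"
  by (induction J rule: infinite_finite_induct) (auto simp: locfrac_zero locfrac_add)

lemma locfrac_divide:
  assumes "locfrac N U s" "h \<in> S N" "\<And>p. p \<in> U \<Longrightarrow> h (R p) \<noteq> 0"
  shows "locfrac 0 U (\<lambda>i p. s i p / h (R p))"
proof (rule locfracI)
  fix p assume p: "p \<in> U"
  obtain m b a where 1: "b \<in> S m" "b (R p) \<noteq> 0" "\<And>i. a i \<in> S (m + N)"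
    "\<And>i q. q \<in> U \<Longrightarrow> s i q * b (R q) = a i (R q)" using locfracE[OF assms(1) p] by metis
  show "\<exists>m b a. b \<in> S m \<and> b (R p) \<noteq> 0 \<and> (\<forall>i. a i \<in> S (m + 0)) \<and>
    (\<forall>i. \<forall>q\<in>U. (s i q / h (R q)) * b (R q) = a i (R q))"
    by (rule exI[of _ "m + N"], rule exI[of _ "\<lambda>c. b c * h c"], rule exI[of _ a])
      (use 1 assms p mult[OF 1(1) assms(2)] in \<open>auto simp: field_simps\<close>)
qed

text \<open>Openness of \<open>V\<close> enters only through a form \<open>g\<close> tested at the
  points of \<open>U\<close>. In this shape the lemma serves the quotient of the cone as well as
  closed subsets of it with the induced topology.\<close>

lemma locfrac_local:
  assumes "\<And>p. p \<in> U \<Longrightarrow> \<exists>V. p \<in> V \<and> V \<subseteq> U \<and> locfrac N V s \<and>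
    (\<exists>n. \<exists>g\<in>S n. g (R p) \<noteq> 0 \<and> (\<forall>q\<in>U. g (R q) \<noteq> 0 \<longrightarrow> q \<in> V))"
  shows "locfrac N U s"
proof (rule locfracI)
  fix p assume p: "p \<in> U"
  obtain V n g where V: "p \<in> V" "V \<subseteq> U" "locfrac N V s"
    "g \<in> S n" "g (R p) \<noteq> 0" "\<forall>q\<in>U. g (R q) \<noteq> 0 \<longrightarrow> q \<in> V"
    using assms[OF p] by blast
  obtain m b a where 1: "b \<in> S m" "b (R p) \<noteq> 0" "\<And>i. a i \<in> S (m + N)"
    "\<And>i q. q \<in> V \<Longrightarrow> s i q * b (R q) = a i (R q)" using locfracE[OF V(3) V(1)] by metis
  show "\<exists>m b a. b \<in> S m \<and> b (R p) \<noteq> 0 \<and> (\<forall>i. a i \<in> S (m + N)) \<and>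
    (\<forall>i. \<forall>q\<in>U. s i q * b (R q) = a i (R q))"
  proof (intro exI conjI allI ballI)
    show "(\<lambda>c. b c * g c) \<in> S (m + n)" by (rule mult[OF 1(1) V(4)])
    show "b (R p) * g (R p) \<noteq> 0" using 1 V by simp
    fix i
    show "(\<lambda>c. a i c * g c) \<in> S (m + n + N)"
      using mult[OF 1(3) V(4), of i] by (simp add: ac_simps)
    fix q assume q: "q \<in> U"
    show "s i q * (b (R q) * g (R q)) = a i (R q) * g (R q)"
    proof (cases "g (R q) = 0")
      case False
      then show ?thesis using 1(4)[of q i] V(6) q by auto
    qed simp
  qed
qed

section \<open>Regular functions as local fractions\<close>

lemma reg_cone_quotient:
  assumes U: "openin ztop U"
  shows "reg (cone_quotient C act S) U = {\<phi> \<in> extensional U. locfrac 0 U (\<lambda>_. \<phi>)}"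
proof (intro equalityI subsetI)
  fix \<phi> assume "\<phi> \<in> reg (cone_quotient C act S) U"
  then have ext: "\<phi> \<in> extensional U" and
    loc: "\<And>x. x \<in> U \<Longrightarrow> \<exists>W m. openin ztop W \<and> x \<in> W \<and> W \<subseteq> U \<and>
              (\<exists>a\<in>S m. \<exists>b\<in>S m. \<forall>c\<in>C. orbit act c \<in> W \<longrightarrow>
                 b c \<noteq> 0 \<and> \<phi> (orbit act c) = a c / b c)"
    by (auto simp: cone_quotient_def)
  have "locfrac 0 U (\<lambda>_. \<phi>)"
  proof (rule locfrac_local)
    fix p assume "p \<in> U"
    then obtain W m a b where W: "openin ztop W" "p \<in> W" "W \<subseteq> U" "a \<in> S m" "b \<in> S m"
      "\<forall>c\<in>C. orbit act c \<in> W \<longrightarrow> b c \<noteq> 0 \<and> \<phi> (orbit act c) = a c / b c"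
      using loc by meson
    have Wp: "W \<subseteq> points" using W(1) openin_cone_topology by blast
    have ab: "b (R q) \<noteq> 0 \<and> \<phi> q = a (R q) / b (R q)" if "q \<in> W" for q
      using W(6) R_in[of q] orbit_R[of q] Wp that by (metis subsetD)
    have "locfrac 0 W (\<lambda>_. \<phi>)"
      by (rule locfracI, rule exI[of _ m], rule exI[of _ b], rule exI[of _ "\<lambda>_. a"])
        (use ab W in auto)
    moreover obtain n g where "g \<in> S n" "g (R p) \<noteq> 0" "\<forall>q\<in>points. g (R q) \<noteq> 0 \<longrightarrow> q \<in> W"
      using W openin_cone_topology by meson
    moreover have "U \<subseteq> points" using U openin_cone_topology by blast
    ultimately show "\<exists>V. p \<in> V \<and> V \<subseteq> U \<and> locfrac 0 V (\<lambda>_. \<phi>) \<and>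
      (\<exists>n. \<exists>g\<in>S n. g (R p) \<noteq> 0 \<and> (\<forall>q\<in>U. g (R q) \<noteq> 0 \<longrightarrow> q \<in> V))"
      using W by blast
  qed
  then show "\<phi> \<in> {\<phi> \<in> extensional U. locfrac 0 U (\<lambda>_. \<phi>)}" using ext by simp
next
  fix \<phi> assume "\<phi> \<in> {\<phi> \<in> extensional U. locfrac 0 U (\<lambda>_. \<phi>)}"
  then have ext: "\<phi> \<in> extensional U" and loc: "locfrac 0 U (\<lambda>_. \<phi>)" by auto
  have Up: "U \<subseteq> points" using U openin_cone_topology by blast
  have "\<exists>W m. openin ztop W \<and> p \<in> W \<and> W \<subseteq> U \<and>
              (\<exists>a\<in>S m. \<exists>b\<in>S m. \<forall>c\<in>C. orbit act c \<in> W \<longrightarrow>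
                 b c \<noteq> 0 \<and> \<phi> (orbit act c) = a c / b c)" if p: "p \<in> U" for p
  proof -
    obtain m b a where 1: "b \<in> S m" "b (R p) \<noteq> 0" "\<And>i::nat. a i \<in> S (m + 0)"
      "\<And>i q. q \<in> U \<Longrightarrow> \<phi> q * b (R q) = a i (R q)" using locfracE[OF loc p] by metis
    let ?W = "{p \<in> points. b (R p) \<noteq> 0} \<inter> U"
    have "b c \<noteq> 0 \<and> \<phi> (orbit act c) = a 0 c / b c" if c: "c \<in> C" "orbit act c \<in> ?W" for c
    proof -
      obtain l where l: "l \<noteq> 0" "c = act l (R (orbit act c))" using R_act[OF c(1)] by blast
      \<comment> \<open>Numerator and denominator scale by the same power of \<open>l\<close>, so
        the fraction found at the representative is valid on the whole orbit.\<close>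
      have "b c = l ^ m * b (R (orbit act c))" "a 0 c = l ^ m * a 0 (R (orbit act c))"
        using homogeneous[OF 1(1), of l "R (orbit act c)"] homogeneous[OF 1(3)[of 0], of l "R (orbit act c)"] l
        by simp_all
      moreover have "\<phi> (orbit act c) * b (R (orbit act c)) = a 0 (R (orbit act c))"
        using 1(4) c by simp
      ultimately show ?thesis using l c by (simp add: field_simps)
    qed
    moreover have "openin ztop ?W" using openin_basic[OF 1(1)] U by (rule openin_Int)
    moreover have "p \<in> ?W" using p 1 Up by auto
    moreover have "a 0 \<in> S m" using 1(3)[of 0] by simp
    ultimately have "openin ztop ?W \<and> p \<in> ?W \<and> ?W \<subseteq> U \<and>
      (\<exists>a\<in>S m. \<exists>b\<in>S m. \<forall>c\<in>C. orbit act c \<in> ?W \<longrightarrow> b c \<noteq> 0 \<and> \<phi> (orbit act c) = a c / b c)"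
      using 1(1) by (intro conjI bexI[of _ b] bexI[of _ "a 0"] ballI impI) simp_all
    then show ?thesis by (intro exI)
  qed
  then show "\<phi> \<in> reg (cone_quotient C act S) U" using ext by (simp add: cone_quotient_def)
qed

lemma reg_closed_subvariety:
  assumes Z: "Z \<subseteq> points" and U: "openin (zar (closed_subvariety (cone_quotient C act S) Z)) U"
  shows "reg (closed_subvariety (cone_quotient C act S) Z) U =
    {\<phi> \<in> extensional U. locfrac 0 U (\<lambda>_. \<phi>)}"
proof (intro equalityI subsetI)
  let ?Y = "cone_quotient C act S"
  have zY: "zar ?Y = ztop" by (simp add: cone_quotient_def)
  fix \<phi> assume "\<phi> \<in> reg (closed_subvariety ?Y Z) U"
  then have ext: "\<phi> \<in> extensional U" and
    loc: "\<And>x. x \<in> U \<Longrightarrow> \<exists>W \<psi>. openin ztop W \<and> x \<in> W \<and> \<psi> \<in> reg ?Y W \<and> (\<forall>y\<in>W \<inter> U. \<phi> y = \<psi> y)"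
    by (auto simp: closed_subvariety_def zY)
  have "locfrac 0 U (\<lambda>_. \<phi>)"
  proof (rule locfrac_local)
    fix p assume p: "p \<in> U"
    then obtain W \<psi> where W: "openin ztop W" "p \<in> W" "\<psi> \<in> reg ?Y W" "\<forall>y\<in>W \<inter> U. \<phi> y = \<psi> y"
      using loc by meson
    have "locfrac 0 W (\<lambda>_. \<psi>)" using W reg_cone_quotient by blast
    then have "locfrac 0 (W \<inter> U) (\<lambda>_. \<psi>)" by (rule locfrac_subset) simp
    then have "locfrac 0 (W \<inter> U) (\<lambda>_. \<phi>)"
      using W(4) by (subst locfrac_cong[of _ _ "\<lambda>_. \<psi>"]) auto
    moreover obtain n g where "g \<in> S n" "g (R p) \<noteq> 0" "\<forall>q\<in>points. g (R q) \<noteq> 0 \<longrightarrow> q \<in> W"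
      using W openin_cone_topology by meson
    moreover have "U \<subseteq> points" using U Z by (auto simp: closed_subvariety_def openin_subtopology)
    ultimately show "\<exists>V. p \<in> V \<and> V \<subseteq> U \<and> locfrac 0 V (\<lambda>_. \<phi>) \<and>
      (\<exists>n. \<exists>g\<in>S n. g (R p) \<noteq> 0 \<and> (\<forall>q\<in>U. g (R q) \<noteq> 0 \<longrightarrow> q \<in> V))"
      using W p by blast
  qed
  then show "\<phi> \<in> {\<phi> \<in> extensional U. locfrac 0 U (\<lambda>_. \<phi>)}" using ext by simp
next
  let ?Y = "cone_quotient C act S"
  have zY: "zar ?Y = ztop" by (simp add: cone_quotient_def)
  fix \<phi> assume "\<phi> \<in> {\<phi> \<in> extensional U. locfrac 0 U (\<lambda>_. \<phi>)}"
  then have ext: "\<phi> \<in> extensional U" and loc: "locfrac 0 U (\<lambda>_. \<phi>)" by auto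
  have "\<exists>W \<psi>. openin ztop W \<and> p \<in> W \<and> \<psi> \<in> reg ?Y W \<and> (\<forall>y\<in>W \<inter> U. \<phi> y = \<psi> y)"
    if p: "p \<in> U" for p
  proof -
    obtain m b a where 1: "b \<in> S m" "b (R p) \<noteq> 0" "\<And>i::nat. a i \<in> S (m + 0)"
      "\<And>i q. q \<in> U \<Longrightarrow> \<phi> q * b (R q) = a i (R q)" using locfracE[OF loc p] by metis
    let ?W = "{p \<in> points. b (R p) \<noteq> 0}"
    \<comment> \<open>The same fraction extends \<open>\<phi>\<close> from the closed set to the
      ambient locus where the denominator is nonzero.\<close>
    let ?\<psi> = "\<lambda>q\<in>?W. a 0 (R q) / b (R q)"
    have W: "openin ztop ?W" by (rule openin_basic[OF 1(1)])
    have "locfrac 0 ?W (\<lambda>_. ?\<psi>)"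
      by (rule locfracI, rule exI[of _ m], rule exI[of _ b], rule exI[of _ "\<lambda>_. a 0"])
        (use 1(1) 1(3)[of 0] in auto)
    then have "?\<psi> \<in> reg ?Y ?W" unfolding reg_cone_quotient[OF W] by auto
    moreover have "\<forall>y\<in>?W \<inter> U. \<phi> y = ?\<psi> y" using 1(4)[of _ 0] by (auto simp: field_simps)
    moreover have "p \<in> ?W"
      using p 1 U Z by (auto simp: closed_subvariety_def openin_subtopology)
    ultimately show ?thesis using W by blast
  qed
  then show "\<phi> \<in> reg (closed_subvariety ?Y Z) U"
    using ext by (auto simp: closed_subvariety_def zY)
qed

lemma cring_reg_ring:
  assumes reg: "reg V U = {\<phi> \<in> extensional U. locfrac 0 U (\<lambda>_. \<phi>)}"
  shows "cring (reg_ring V U)"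
proof -
  have restr: "locfrac 0 U (\<lambda>_. \<lambda>x\<in>U. h x) = locfrac 0 U (\<lambda>_. h)" for h
    by (rule locfrac_cong) simp
  have add: "(\<lambda>x\<in>U. a x + b x) \<in> reg V U" if "a \<in> reg V U" "b \<in> reg V U" for a b
    using that locfrac_add[of 0 U "\<lambda>_. a" "\<lambda>_. b"] by (simp add: reg restr)
  have mult: "(\<lambda>x\<in>U. a x * b x) \<in> reg V U" if "a \<in> reg V U" "b \<in> reg V U" for a b
    using that locfrac_mult[of 0 U "\<lambda>_. a" 0 "\<lambda>_. b"] by (simp add: reg restr)
  have const: "(\<lambda>x\<in>U. z) \<in> reg V U" for z
    using locfrac_const[of U "\<lambda>_. z"] by (simp add: reg restr)
  have ext: "restrict a U = a" "\<And>x. x \<notin> U \<Longrightarrow> a x = undefined" if "a \<in> reg V U" for a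
  proof -
    have a: "a \<in> extensional U" using that by (simp add: reg)
    show "restrict a U = a" using a by (rule extensional_restrict)
    show "a x = undefined" if "x \<notin> U" for x using a that by (rule extensional_arb)
  qed
  have inv: "(\<lambda>x\<in>U. - 1 * a x) \<in> reg V U" if "a \<in> reg V U" for a
  proof -
    have "(\<lambda>x\<in>U. - 1 * a x) = (\<lambda>x\<in>U. (\<lambda>x\<in>U. - 1) x * a x)" by (rule restrict_ext) simp
    then show ?thesis using mult[OF const[of "-1"] that] by metis
  qed
  show ?thesis
  proof (rule cringI)
    show "abelian_group (reg_ring V U)"
    proof (rule abelian_groupI)
      fix a assume a: "a \<in> carrier (reg_ring V U)"
      then show "\<exists>b\<in>carrier (reg_ring V U). b \<oplus>\<^bsub>reg_ring V U\<^esub> a = \<zero>\<^bsub>reg_ring V U\<^esub>"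
        using inv[of a] by (intro bexI[of _ "\<lambda>x\<in>U. - 1 * a x"]) (auto simp: reg_ring_def fun_eq_iff)
    qed (auto simp: reg_ring_def add const fun_eq_iff ext)
    show "comm_monoid (reg_ring V U)"
      by (rule comm_monoidI) (auto simp: reg_ring_def mult const fun_eq_iff ext)
  qed (auto simp: reg_ring_def fun_eq_iff distrib_right)
qed

text \<open>A generic linear combination of two denominators is nonzero wherever one of them is.\<close>

lemma locfrac_common_denominator:
  assumes s: "locfrac N U s" and l: "l \<in> S 1"
    and T: "finite T" "T \<subseteq> U" "\<And>p. p \<in> T \<Longrightarrow> l (R p) \<noteq> 0"
  shows "\<exists>m b a. b \<in> S m \<and> (\<forall>p\<in>T. b (R p) \<noteq> 0) \<and> (\<forall>i. a i \<in> S (m + N)) \<and>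
    (\<forall>i. \<forall>q\<in>U. s i q * b (R q) = a i (R q))"
  using T
proof (induction T rule: finite_induct)
  case empty
  show ?case
    by (rule exI[of _ 0], rule exI[of _ "\<lambda>_. 0"], rule exI[of _ "\<lambda>_ _. 0"]) (simp add: zero)
next
  case (insert p T)
  then obtain m b a where 1: "b \<in> S m" "\<And>p. p \<in> T \<Longrightarrow> b (R p) \<noteq> 0" "\<And>i. a i \<in> S (m + N)"
    "\<And>i q. q \<in> U \<Longrightarrow> s i q * b (R q) = a i (R q)" by force
  obtain m' b' a' where 2: "b' \<in> S m'" "b' (R p) \<noteq> 0" "\<And>i. a' i \<in> S (m' + N)"
    "\<And>i q. q \<in> U \<Longrightarrow> s i q * b' (R q) = a' i (R q)"
    using locfracE[OF s, of p] insert.prems by (metis insert_subset)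
  \<comment> \<open>The powers of \<open>l\<close> raise both denominators to degree
    \<open>m + m'\<close> so that they can be added; since \<open>l\<close> is nonzero on the finite
    set, this creates no zeros there.\<close>
  let ?b = "\<lambda>z c. l c ^ m' * b c + z * (l c ^ m * b' c)"
  let ?a = "\<lambda>z i c. l c ^ m' * a i c + z * (l c ^ m * a' i c)"
  have lp: "(\<lambda>c. l c ^ n) \<in> S n" for n using pow[OF l, of n] by simp
  have "finite {z. ?b z (R q) = 0}" if "q \<in> insert p T" for q
  proof (cases "b' (R q) = 0")
    case True
    then have "q \<in> T" using that 2 by auto
    then show ?thesis using True 1(2) insert.prems by auto
  next
    case False
    have "{z. ?b z (R q) = 0} \<subseteq> {- (l (R q) ^ m' * b (R q)) / (l (R q) ^ m * b' (R q))}"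
      using False insert.prems(2)[OF that] by (auto simp: field_simps eq_neg_iff_add_eq_0)
    then show ?thesis by (rule finite_subset) simp
  qed
  then have "finite (\<Union>q\<in>insert p T. {z. ?b z (R q) = 0})"
    using insert.hyps by blast
  then obtain z where z: "\<And>q. q \<in> insert p T \<Longrightarrow> ?b z (R q) \<noteq> 0"
    using ex_new_if_finite[OF infinite_UNIV_char_0[where 'a = complex]] by blast
  show ?case
  proof (intro exI conjI ballI allI)
    have "(\<lambda>c. l c ^ m' * b c) \<in> S (m + m')" "(\<lambda>c. l c ^ m * b' c) \<in> S (m + m')"
      using mult[OF lp 1(1)] mult[OF lp 2(1)] by (metis add.commute, metis)
    then show "?b z \<in> S (m + m')" by (intro add scale)
    show "?b z (R q) \<noteq> 0" if "q \<in> insert p T" for q using z[OF that] .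
    show "?a z i \<in> S (m + m' + N)" for i
    proof -
      have "(\<lambda>c. l c ^ m' * a i c) \<in> S (m + m' + N)" "(\<lambda>c. l c ^ m * a' i c) \<in> S (m + m' + N)"
        using mult[OF lp 1(3)] mult[OF lp 2(3)] by (metis add.commute add.assoc, metis add.assoc)
      then show ?thesis by (intro add scale)
    qed
    show "s i q * ?b z (R q) = ?a z i (R q)" if "q \<in> U" for i q
      unfolding 1(4)[OF that, symmetric] 2(4)[OF that, symmetric] by (simp add: algebra_simps)
  qed
qed

end

section \<open>Forms on the plane and on the total space of a line bundle\<close>

lemma forms_zero: "(\<lambda>_. 0) \<in> forms m"
  unfolding forms_def by (auto intro!: exI[of _ "\<lambda>_ _. 0"])

lemma forms_add:
  assumes "g \<in> forms m" "h \<in> forms m"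
  shows "(\<lambda>v. g v + h v) \<in> forms m"
proof -
  obtain a b where
    "g = (\<lambda>v. \<Sum>i\<le>m. \<Sum>j\<le>m - i. a i j * (v$1)^i * (v$2)^j * (v$3)^(m - i - j))"
    "h = (\<lambda>v. \<Sum>i\<le>m. \<Sum>j\<le>m - i. b i j * (v$1)^i * (v$2)^j * (v$3)^(m - i - j))"
    using assms by (auto simp: forms_def)
  then show ?thesis
    by (auto simp: forms_def sum.distrib algebra_simps intro!: exI[of _ "\<lambda>i j. a i j + b i j"])
qed

lemma forms_monomial:
  assumes "i + j + l = m"
  shows "(\<lambda>v. c * (v$1)^i * (v$2)^j * (v$3)^l) \<in> forms m"
proof -
  have "(\<Sum>i'\<le>m. \<Sum>j'\<le>m - i'. (if i' = i then if j' = j then c else 0 else 0) *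
      (v$1)^i' * (v$2)^j' * (v$3)^(m - i' - j')) = c * (v$1)^i * (v$2)^j * (v$3)^l" for v :: "complex^3"
  proof -
    have "(\<Sum>i'\<le>m. \<Sum>j'\<le>m - i'. (if i' = i then if j' = j then c else 0 else 0) *
        (v$1)^i' * (v$2)^j' * (v$3)^(m - i' - j'))
      = (\<Sum>i'\<le>m. if i' = i then (\<Sum>j'\<le>m - i. if j' = j then c * (v$1)^i * (v$2)^j * (v$3)^(m - i - j) else 0) else 0)"
    proof (intro sum.cong refl)
      fix i'
      show "(\<Sum>j'\<le>m - i'. (if i' = i then if j' = j then c else 0 else 0) *
          (v$1)^i' * (v$2)^j' * (v$3)^(m - i' - j'))
        = (if i' = i then (\<Sum>j'\<le>m - i. if j' = j then c * (v$1)^i * (v$2)^j * (v$3)^(m - i - j) else 0) else 0)"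
      proof (cases "i' = i")
        case True
        show ?thesis unfolding True if_P[OF refl] by (intro sum.cong refl) simp
      qed simp
    qed
    also have "\<dots> = c * (v$1)^i * (v$2)^j * (v$3)^l"
      using assms by (auto simp: sum.delta)
    finally show ?thesis .
  qed
  then show ?thesis
    unfolding forms_def by (auto intro!: exI[of _ "\<lambda>i' j'. if i' = i then if j' = j then c else 0 else 0"])
qed

text \<open>Forms are functions given by some coefficients; this rule hides the double sum, so that
  closure properties are checked on monomials. The zero form is a monomial with coefficient
  0.\<close>

lemma forms_induct [consumes 1, case_names add monomial]:
  assumes h: "h \<in> forms m"
    and add: "\<And>a b. P a \<Longrightarrow> P b \<Longrightarrow> P (\<lambda>v. a v + b v)"
    and monomial: "\<And>c i j l. i + j + l = m \<Longrightarrow> P (\<lambda>v. c * (v$1)^i * (v$2)^j * (v$3)^l)"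
  shows "P h"
proof -
  have P0: "P (\<lambda>_. 0)" using monomial[of 0 0 m 0] by simp
  have sum: "(\<And>i. i \<in> I \<Longrightarrow> P (a i)) \<Longrightarrow> P (\<lambda>v. \<Sum>i\<in>I. a i v)"
    for I :: "nat set" and a
    by (induction I rule: infinite_finite_induct) (auto simp: P0 add)
  obtain a where
    "h = (\<lambda>v. \<Sum>i\<le>m. \<Sum>j\<le>m - i. a i j * (v$1)^i * (v$2)^j * (v$3)^(m - i - j))"
    using h by (auto simp: forms_def)
  then show ?thesis by (auto intro!: sum monomial)
qed

lemma forms_mult:
  assumes g: "g \<in> forms m" and h: "h \<in> forms n"
  shows "(\<lambda>v. g v * h v) \<in> forms (m + n)"
  using g
proof (induction rule: forms_induct)
  case (add a b)
  then show ?case using forms_add by (fastforce simp: distrib_right)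
next
  case (monomial c i j l)
  show ?case using h
  proof (induction rule: forms_induct)
    case (add a b)
    then show ?case using forms_add by (fastforce simp: distrib_left)
  next
    case (monomial c' i' j' l')
    then show ?case
      using forms_monomial[of "i + i'" "j + j'" "l + l'" "m + n" "c * c'"] \<open>i + j + l = m\<close>
      by (simp add: power_add algebra_simps)
  qed
qed

interpretation forms: graded_ring forms
proof
  show "(\<lambda>_. z) \<in> forms 0" for z
    using forms_monomial[of 0 0 0 0 z] by simp
qed (auto intro: forms_add forms_mult forms_zero)

lemma forms_homogeneous: "h \<in> forms m \<Longrightarrow> h (l *s v) = l ^ m * h v"
proof (induction rule: forms_induct)
  case (monomial c i j n)
  then show ?case by (auto simp: power_mult_distrib power_add algebra_simps)
qed (simp add: distrib_left)

lemma forms_linear: "(\<lambda>v. (A *v v) $ i) \<in> forms 1"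
proof -
  have "(\<lambda>v::complex^3. v $ j) \<in> forms 1" for j
    using forms_monomial[of 1 0 0 1 1] forms_monomial[of 0 1 0 1 1] forms_monomial[of 0 0 1 1 1]
      exhaust_3[of j] by auto
  then show ?thesis
    unfolding matrix_vector_mult_def by (auto intro!: forms.sum forms.scale)
qed

lemma forms_linear_substitution:
  assumes "h \<in> forms m"
  shows "(\<lambda>v. h (A *v v)) \<in> forms m"
  using assms
proof (induction rule: forms_induct)
  case (add a b)
  then show ?case by (rule forms_add)
next
  case (monomial c i j l)
  have L: "(\<lambda>v. (A *v v) $ r ^ n) \<in> forms n" for r n
    using forms.pow[OF forms_linear[of A r], of n] by simp
  have "(\<lambda>v. c * ((A *v v) $ 1 ^ i * (A *v v) $ 2 ^ j * (A *v v) $ 3 ^ l)) \<in> forms (i + j + l)"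
    by (intro forms.scale forms_mult L)
  then show ?case using monomial by (simp add: mult.assoc)
qed

lemma forms_on_line:
  assumes "h \<in> forms m"
  shows "\<exists>p. \<forall>s. h (u + s *s w) = poly p s"
  using assms
proof (induction rule: forms_induct)
  case (add a b)
  then show ?case by (metis poly_add)
next
  case (monomial c i j l)
  show ?case
    by (rule exI[of _ "Polynomial.smult c ([:u$1, w$1:]^i * [:u$2, w$2:]^j * [:u$3, w$3:]^l)"]) simp
qed

text \<open>On the line through \<open>u\<close> and \<open>w\<close> both forms become polynomials
  in one variable \<open>s\<close>. If \<open>g u\<close> were nonzero, both would be nonzero
  polynomials, as seen at \<open>s = 0\<close> and \<open>s = 1\<close>, with product zero.\<close>

lemma forms_no_zero_divisors:
  assumes "g \<in> forms m" "h \<in> forms n" "\<And>v. g v * h v = 0" "h w \<noteq> 0"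
  shows "g u = 0"
proof (rule ccontr)
  assume "g u \<noteq> 0"
  obtain p q where p: "\<And>s. g (u + s *s (w - u)) = poly p s" and q: "\<And>s. h (u + s *s (w - u)) = poly q s"
    using forms_on_line[OF assms(1), of u "w - u"] forms_on_line[OF assms(2), of u "w - u"] by metis
  have "p \<noteq> 0" "q \<noteq> 0"
    using p[of 0] q[of 1] \<open>g u \<noteq> 0\<close> \<open>h w \<noteq> 0\<close> by (auto simp: vec_eq_iff)
  moreover have "poly (p * q) s = 0" for s
    using assms(3) p q by (metis poly_mult)
  then have "p * q = 0" using poly_all_0_iff_0 by blast
  ultimately show False by simp
qed

section \<open>Forms on the total space\<close>

lemma bundle_forms_zero: "(\<lambda>_. 0) \<in> bundle_forms k m"
  unfolding bundle_forms_def by (auto intro!: exI[of _ "\<lambda>_ _. 0"] forms_zero)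

lemma bundle_forms_add:
  assumes "F \<in> bundle_forms k m" "G \<in> bundle_forms k m"
  shows "(\<lambda>c. F c + G c) \<in> bundle_forms k m"
proof -
  obtain h h' where "\<forall>j\<le>m div k. h j \<in> forms (m - k * j)" "F = (\<lambda>(v, t). \<Sum>j\<le>m div k. h j v * t ^ j)"
    "\<forall>j\<le>m div k. h' j \<in> forms (m - k * j)" "G = (\<lambda>(v, t). \<Sum>j\<le>m div k. h' j v * t ^ j)"
    using assms by (auto simp: bundle_forms_def)
  then show ?thesis
    unfolding bundle_forms_def
    by (auto simp: sum.distrib algebra_simps intro!: exI[of _ "\<lambda>j v. h j v + h' j v"] forms_add)
qed

context
  fixes k :: nat assumes k: "k > 0"
begin

lemma bundle_forms_monomial:
  assumes "k * j \<le> m" "h \<in> forms (m - k * j)"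
  shows "(\<lambda>(v, t). h v * t ^ j) \<in> bundle_forms k m"
proof -
  have j: "j \<le> m div k" using assms(1) k by (simp add: less_eq_div_iff_mult_less_eq mult.commute)
  let ?h = "\<lambda>i v. if i = j then h v else 0"
  have "(\<Sum>i\<le>m div k. ?h i v * t ^ i) = h v * t ^ j" for v t
  proof -
    have "(\<Sum>i\<le>m div k. ?h i v * t ^ i) = (\<Sum>i\<le>m div k. if i = j then h v * t ^ j else 0)"
      by (intro sum.cong) auto
    then show ?thesis using j by simp
  qed
  moreover have "?h i \<in> forms (m - k * i)" for i
    using assms forms_zero by (cases "i = j") auto
  ultimately show ?thesis
    unfolding bundle_forms_def by (auto intro!: exI[of _ ?h])
qed

lemma bundle_forms_induct [consumes 1, case_names add monomial]:
  assumes F: "F \<in> bundle_forms k m"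
    and add: "\<And>a b. P a \<Longrightarrow> P b \<Longrightarrow> P (\<lambda>c. a c + b c)"
    and monomial: "\<And>h j. k * j \<le> m \<Longrightarrow> h \<in> forms (m - k * j) \<Longrightarrow> P (\<lambda>(v, t). h v * t ^ j)"
  shows "P F"
proof -
  have P0: "P (\<lambda>_. 0)" using monomial[of 0 "\<lambda>_. 0"] forms_zero by (simp add: case_prod_unfold)
  have sum: "(\<And>i. i \<in> I \<Longrightarrow> P (a i)) \<Longrightarrow> P (\<lambda>v. \<Sum>i\<in>I. a i v)"
    for I :: "nat set" and a
    by (induction I rule: infinite_finite_induct) (auto simp: P0 add)
  obtain h where h: "\<And>j. j \<le> m div k \<Longrightarrow> h j \<in> forms (m - k * j)"
    "F = (\<lambda>(v, t). \<Sum>j\<le>m div k. h j v * t ^ j)"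
    using F by (auto simp: bundle_forms_def)
  have "P (\<lambda>c. \<Sum>j\<le>m div k. (\<lambda>(v, t). h j v * t ^ j) c)"
  proof (rule sum)
    fix j assume "j \<in> {..m div k}"
    then show "P (\<lambda>(v, t). h j v * t ^ j)"
      using k by (intro monomial h) (auto simp: less_eq_div_iff_mult_less_eq mult.commute)
  qed
  then show ?thesis unfolding h(2) by (simp add: case_prod_unfold)
qed

lemma bundle_forms_mult:
  assumes F: "F \<in> bundle_forms k m" and G: "G \<in> bundle_forms k n"
  shows "(\<lambda>c. F c * G c) \<in> bundle_forms k (m + n)"
  using F
proof (induction rule: bundle_forms_induct)
  case (add a b)
  then show ?case using bundle_forms_add by (fastforce simp: distrib_right)
next
  case (monomial h j)
  note 1 = this
  show ?case using G
  proof (induction rule: bundle_forms_induct)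
    case (add a b)
    then show ?case using bundle_forms_add by (fastforce simp: distrib_left)
  next
    case (monomial h' j')
    have "(m - k * j) + (n - k * j') = m + n - k * (j + j')"
      using 1 monomial by (simp add: distrib_left)
    then have "(\<lambda>v. h v * h' v) \<in> forms (m + n - k * (j + j'))"
      using forms_mult[OF 1(2) monomial(2)] by simp
    then have "(\<lambda>(v, t). (h v * h' v) * t ^ (j + j')) \<in> bundle_forms k (m + n)"
      using 1 monomial by (intro bundle_forms_monomial) (auto simp: distrib_left)
    then show ?case by (simp add: case_prod_unfold power_add algebra_simps)
  qed
qed

lemma bundle_forms_pullback: "h \<in> forms m \<Longrightarrow> (\<lambda>c. h (fst c)) \<in> bundle_forms k m"
  using bundle_forms_monomial[of 0 m h] by (simp add: case_prod_unfold)

lemma bundle_forms_tautological: "snd \<in> bundle_forms k k"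
  using bundle_forms_monomial[of 1 k "\<lambda>_. 1"] forms.const by (simp add: case_prod_unfold)

lemma bundle_forms_graded_ring: "graded_ring (bundle_forms k)"
proof
  show "(\<lambda>_. z) \<in> bundle_forms k 0" for z
    using bundle_forms_pullback[OF forms.const] by simp
qed (auto intro: bundle_forms_add bundle_forms_mult bundle_forms_zero)

lemma bundle_forms_homogeneous: "F \<in> bundle_forms k m \<Longrightarrow> F (bundle_act k l c) = l ^ m * F c"
proof (induction rule: bundle_forms_induct)
  case (monomial h j)
  have "l ^ (m - k * j) * l ^ (k * j) = l ^ m"
    using monomial by (simp flip: power_add)
  then have "(l ^ (m - k * j) * h v) * (l ^ k * t) ^ j = l ^ m * (h v * t ^ j)" for v t
    unfolding power_mult_distrib power_mult[symmetric] by (metis mult.assoc mult.left_commute)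
  then show ?case
    by (simp add: bundle_act_def case_prod_unfold forms_homogeneous[OF monomial(2)])
qed (simp add: distrib_left)

text \<open>For \<open>w\<close> a \<open>d\<close>-th root of unity, \<open>t \<mapsto> w t\<close>
  is a deck transformation of the covering. Conjugates of a form are thus forms of the same degree,
  which is what norms are built from.\<close>

lemma bundle_forms_rotate:
  assumes "F \<in> bundle_forms k m"
  shows "(\<lambda>(v, t). F (v, w * t)) \<in> bundle_forms k m"
  using assms
proof (induction rule: bundle_forms_induct)
  case (add a b)
  then show ?case using bundle_forms_add by (fastforce simp: case_prod_unfold)
next
  case (monomial h j)
  then have "(\<lambda>(v, t). (w ^ j * h v) * t ^ j) \<in> bundle_forms k m"
    by (intro bundle_forms_monomial forms.scale)
  then show ?case by (simp add: case_prod_unfold power_mult_distrib algebra_simps)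
qed

end

section \<open>Roots of unity\<close>

text \<open>A nonzero \<open>w\<close> has \<open>n\<close> distinct \<open>n\<close>-th roots, more
  than the degree allows. The condition \<open>w \<noteq> 0\<close> is what later confines
  comparisons of polynomials to points off the branch curve.\<close>

lemma poly_eq_0_of_many_roots:
  fixes p :: "complex poly"
  assumes "degree p < n" "w \<noteq> 0" "\<And>z. z ^ n = w \<Longrightarrow> poly p z = 0"
  shows "p = 0"
proof (rule ccontr)
  assume p: "p \<noteq> 0"
  have n: "n > 0" using assms(1) by simp
  have "n = card {z::complex. z ^ n = w}" using card_nth_roots[OF assms(2) n] by simp
  also have "\<dots> \<le> card {z. poly p z = 0}"
    using assms(3) p by (intro card_mono poly_roots_finite) auto
  also have "\<dots> \<le> degree p" using p by (rule card_poly_roots_bound)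
  finally show False using assms(1) by simp
qed

definition root1 :: "nat \<Rightarrow> complex" where "root1 n = cis (2 * pi / n)"

lemma root1_power: "n > 0 \<Longrightarrow> root1 n ^ n = 1"
  by (simp add: root1_def Complex.DeMoivre)

lemma inj_root1_power: "n > 0 \<Longrightarrow> inj_on (\<lambda>i. root1 n ^ i) {..<n}"
  using bij_betw_imp_inj_on[OF Complex.bij_betw_roots_unity[of n]]
  by (simp add: root1_def Complex.DeMoivre mult_ac)

text \<open>Geometric sum of a root of unity other than 1. It makes the average over the deck
  transformations kill \<open>t ^ r\<close> for \<open>0 < r < n\<close>.\<close>

lemma sum_root1_power:
  assumes "0 < r" "r < n"
  shows "(\<Sum>i<n. root1 n ^ (i * r)) = 0"
proof -
  have "root1 n ^ r \<noteq> 1"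
    using inj_onD[OF inj_root1_power[of n], of r 0] assms by auto
  moreover have "(root1 n ^ r) ^ n = 1"
    using root1_power[of n] assms by (metis gr_implies_not0 mult.commute neq0_conv power_mult power_one)
  ultimately show ?thesis
    using geometric_sum[of "root1 n ^ r" n] by (simp add: power_mult mult.commute flip: power_mult)
qed

text \<open>Both \<open>?p\<close> and \<open>z ^ n - 1\<close> are monic of degree \<open>n\<close>
  and vanish at all \<open>n\<close>-th roots of unity, so their difference has too many roots for
  its degree. Scaling by \<open>b\<close> gives the homogeneous version.\<close>

lemma prod_root1:
  fixes a b :: complex
  assumes n: "n > 0"
  shows "(\<Prod>i<n. a - root1 n ^ i * b) = a ^ n - b ^ n"
proof (cases "b = 0")
  case True
  then show ?thesis using n by (simp add: zero_power)
next
  case False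
  let ?p = "\<Prod>i<n. [:- (root1 n ^ i), 1:]"
  have deg: "degree ?p = n" by (subst degree_prod_eq_sum_degree) auto
  have "lead_coeff ?p = 1" by (simp add: lead_coeff_prod)
  then have c: "coeff ?p n = 1" using deg by simp
  have "?p - (monom 1 n - 1) = 0"
  proof (rule ccontr)
    assume nz: "?p - (monom 1 n - 1) \<noteq> 0"
    let ?q = "?p - (monom 1 n - 1)"
    have "degree ?q \<le> n"
      using deg by (intro degree_diff_le) (auto simp: degree_monom_le)
    moreover have "coeff ?q n = 0" using c n by simp
    ultimately have "degree ?q < n" using nz
      by (metis leading_coeff_0_iff le_neq_implies_less)
    moreover have "poly ?q z = 0" if "z ^ n = 1" for z
    proof -
      have "z \<in> (\<lambda>i. root1 n ^ i) ` {..<n}"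
        using bij_betw_imp_surj_on[OF Complex.bij_betw_roots_unity[OF n]] that
        by (auto simp: root1_def Complex.DeMoivre mult_ac)
      then have "poly ?p z = 0" using n by (auto simp: poly_prod)
      then show ?thesis using that by (simp add: poly_monom)
    qed
    ultimately show False using poly_eq_0_of_many_roots[of ?q n 1] nz by auto
  qed
  then have p: "?p = monom 1 n - 1" by simp
  have "(\<Prod>i<n. a - root1 n ^ i * b) = (\<Prod>i<n. b * (a / b - root1 n ^ i))"
    using False by (intro prod.cong) (auto simp: field_simps)
  also have "\<dots> = b ^ n * poly ?p (a / b)" by (simp add: prod.distrib poly_prod)
  also have "\<dots> = a ^ n - b ^ n" using False by (simp add: p poly_monom field_simps)
  finally show ?thesis .
qed

section \<open>Forms vanishing on a Fermat curve\<close>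

text \<open>For fixed \<open>x\<close> and \<open>y\<close> with
  \<open>x ^ n + y ^ n \<noteq> 0\<close> the form is a polynomial in \<open>z\<close> of degree at
  most \<open>n\<close> that vanishes at \<open>n\<close> distinct points, hence a multiple of the
  Fermat polynomial.\<close>

lemma form_vanishing_on_fermat:
  assumes h: "h \<in> forms n" and n: "n > 0"
    and van: "\<And>v. v$1 ^ n + v$2 ^ n = v$3 ^ n \<Longrightarrow> h v = 0"
  shows "\<exists>c. \<forall>v. h v = c * (v$1 ^ n + v$2 ^ n - v$3 ^ n)"
proof -
  \<comment> \<open>The order of the quantifiers matters: \<open>z ^ n\<close> is the only monomial
    of degree \<open>n\<close> in \<open>z\<close>, so its coefficient \<open>c\<close> does not
    depend on \<open>x\<close> and \<open>y\<close>.\<close>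
  have "\<exists>c. \<forall>x y. \<exists>p. degree p < n \<and> (\<forall>z. h (vector [x, y, z]) = c * z ^ n + poly p z)"
    using h
  proof (induction rule: forms_induct)
    case (add a b)
    then obtain c c' where
      "\<And>x y. \<exists>p. degree p < n \<and> (\<forall>z. a (vector [x, y, z]) = c * z ^ n + poly p z)"
      "\<And>x y. \<exists>p. degree p < n \<and> (\<forall>z. b (vector [x, y, z]) = c' * z ^ n + poly p z)"
      by blast
    note 1 = this
    show ?case
    proof (intro exI[of _ "c + c'"] allI)
      fix x y
      obtain p q where "degree p < n" "\<And>z. a (vector [x, y, z]) = c * z ^ n + poly p z"
        "degree q < n" "\<And>z. b (vector [x, y, z]) = c' * z ^ n + poly q z"
        using 1[of x y] by blast
      then show "\<exists>p. degree p < n \<and>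
        (\<forall>z. a (vector [x, y, z]) + b (vector [x, y, z]) = (c + c') * z ^ n + poly p z)"
        by (intro exI[of _ "p + q"]) (auto simp: degree_add_less algebra_simps)
    qed
  next
    case (monomial c i j l)
    show ?case
    proof (cases "l = n")
      case True
      then show ?thesis using monomial n by (intro exI[of _ c] allI exI[of _ 0]) auto
    next
      case False
      then have "degree (monom (c * x ^ i * y ^ j) l) < n" for x y
        using monomial by (intro le_less_trans[OF degree_monom_le]) auto
      then show ?thesis
        by (auto intro!: exI[of _ 0] exI[of _ "monom (c * x ^ i * y ^ j) l" for x y] simp: poly_monom)
    qed
  qed
  then obtain c where c: "\<And>x y. \<exists>p. degree p < n \<and> (\<forall>z. h (vector [x, y, z]) = c * z ^ n + poly p z)"
    by blast
  have off: "h (vector [x, y, z]) = c * (z ^ n - (x ^ n + y ^ n))" if w: "x ^ n + y ^ n \<noteq> 0" for x y z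
  proof -
    obtain p where p: "degree p < n" "\<And>z. h (vector [x, y, z]) = c * z ^ n + poly p z"
      using c by blast
    \<comment> \<open>On the roots of \<open>z ^ n = x ^ n + y ^ n\<close> the leading term is
      constant; replacing it by that constant brings the degree below \<open>n\<close>.\<close>
    have "p + [:c * (x ^ n + y ^ n):] = 0"
    proof (rule poly_eq_0_of_many_roots)
      show "degree (p + [:c * (x ^ n + y ^ n):]) < n" using p n by (auto intro!: degree_add_less)
      show "poly (p + [:c * (x ^ n + y ^ n):]) z = 0" if "z ^ n = x ^ n + y ^ n" for z
        using van[of "vector [x, y, z]"] p(2)[of z] that by (simp add: add.commute)
    qed (rule w)
    then have "poly (p + [:c * (x ^ n + y ^ n):]) z = 0" by simp
    then show ?thesis using p(2)[of z] by (simp add: algebra_simps)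
  qed
  have pow: "(\<lambda>v::complex^3. v$i ^ n) \<in> forms n" for i
    using forms.pow[OF forms_linear[of "mat 1" i], of n] by simp
  \<comment> \<open>The lines \<open>x ^ n + y ^ n = 0\<close>, excluded so far, are reached by
    cancelling this factor from an identity of forms.\<close>
  have "h v - (- c) * (v$1 ^ n + v$2 ^ n - v$3 ^ n) = 0" for v
  proof (rule forms_no_zero_divisors)
    show "(\<lambda>v. h v - (- c) * (v$1 ^ n + v$2 ^ n - v$3 ^ n)) \<in> forms n"
      by (intro forms.diff forms.scale forms.add h pow)
    show "(\<lambda>v::complex^3. v$1 ^ n + v$2 ^ n) \<in> forms n"
      by (intro forms.add pow)
    show "(h v - (- c) * (v$1 ^ n + v$2 ^ n - v$3 ^ n)) * (v$1 ^ n + v$2 ^ n) = 0" for v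
    proof (cases "v$1 ^ n + v$2 ^ n = 0")
      case False
      have "v = vector [v$1, v$2, v$3]" by (simp add: vec_eq_iff forall_3)
      then have "h v = c * (v$3 ^ n - (v$1 ^ n + v$2 ^ n))" using off[OF False, of "v$3"] by simp
      then show ?thesis by (simp add: algebra_simps)
    qed simp
    show "(vector [1, 0, 0] :: complex^3)$1 ^ n + (vector [1, 0, 0] :: complex^3)$2 ^ n \<noteq> 0"
      using n by (simp add: zero_power)
  qed
  then show ?thesis by (metis eq_iff_diff_eq_0)
qed

text \<open>Equality of the two sets of points suffices. One inclusion makes \<open>f\<close>, in
  suitable coordinates, a multiple of the Fermat form; the other excludes the multiple zero, since
  \<open>[1, 0, 0]\<close> is not on the Fermat curve.\<close>

lemma fermat_form:
  assumes n: "n > 0" and f: "f \<in> forms n"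
    and fermat: "fermat_curve n (zero_locus plane_cone (*s) f)"
  obtains A :: "complex^3^3" and c where "invertible A" "c \<noteq> 0"
    "\<And>v. f v = c * ((A *v v)$1 ^ n + (A *v v)$2 ^ n - (A *v v)$3 ^ n)"
proof -
  let ?F = "\<lambda>v::complex^3. v$1 ^ n + v$2 ^ n - v$3 ^ n"
  obtain B :: "complex^3^3" where B: "invertible B"
    and eq: "zero_locus plane_cone (*s) f = (\<lambda>x. (*v) B ` x) ` zero_locus plane_cone (*s) ?F"
    using fermat by (auto simp: fermat_curve_def)
  obtain A where AB: "A ** B = mat 1" "B ** A = mat 1" using B by (auto simp: invertible_def)
  have AB': "A *v (B *v v) = v" "B *v (A *v v) = v" for v
    using AB by (simp_all add: matrix_vector_mul_assoc)
  have nz: "B *v v \<noteq> 0" if "v \<noteq> 0" for v using AB'(1)[of v] that by auto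
  have orb: "(*v) B ` orbit (*s) v = orbit (*s) (B *v v)" for v
    unfolding orbit_def vector_scalar_commute[symmetric] by blast
  \<comment> \<open>The origin lies on no orbit of the plane cone, while the vanishing has to be
    shown for all vectors.\<close>
  have f0: "f 0 = 0" using forms_homogeneous[OF f, of 0 "0::complex^3"] n by (simp add: zero_power)
  have F_form: "?F \<in> forms n"
    using forms.pow[OF forms_linear[of "mat 1"], of _ n] by (auto intro!: forms.diff forms.add)
  have self: "v \<in> orbit (*s) v" for v :: "complex^3"
    unfolding orbit_def by (auto intro!: exI[of _ 1])
  have "f (B *v v) = 0" if F: "?F v = 0" for v
  proof (cases "v = 0")
    case False
    then have "orbit (*s) (B *v v) \<in> zero_locus plane_cone (*s) f"
      unfolding eq orb[symmetric] using F by (auto simp: zero_locus_def)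
    then obtain c where c: "f c = 0" "orbit (*s) (B *v v) = orbit (*s) c"
      by (auto simp: zero_locus_def)
    then obtain l where "B *v v = l *s c" using self[of "B *v v"] by (auto simp: orbit_def)
    then show ?thesis using forms_homogeneous[OF f] c by simp
  qed (simp add: f0)
  then obtain c where c: "\<And>v. f (B *v v) = c * ?F v"
    using form_vanishing_on_fermat[OF forms_linear_substitution[OF f, of B] n] by auto
  have fA: "f v = c * ?F (A *v v)" for v using c[of "A *v v"] AB' by simp
  have "c \<noteq> 0"
  proof
    assume "c = 0"
    let ?e = "vector [1, 0, 0] :: complex^3"
    have e: "?e \<noteq> 0" by (metis vector_3(1) zero_index zero_neq_one)
    have "orbit (*s) (B *v ?e) \<in> zero_locus plane_cone (*s) f"
      using fA \<open>c = 0\<close> nz[OF e] by (auto simp: zero_locus_def)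
    then obtain v where v: "v \<noteq> 0" "?F v = 0" "orbit (*s) (B *v ?e) = orbit (*s) (B *v v)"
      unfolding eq using orb by (auto simp: zero_locus_def)
    then obtain l where "B *v ?e = l *s (B *v v)" using self[of "B *v ?e"] by (auto simp: orbit_def)
    then have "A *v (B *v ?e) = A *v (l *s (B *v v))" by simp
    then have "?e = l *s v" by (simp add: AB' vector_scalar_commute)
    then have "?F ?e = l ^ n * ?F v" using forms_homogeneous[OF F_form] by metis
    then show False using v n by (simp add: zero_power)
  qed
  moreover have "invertible A" using AB by (auto simp: invertible_def)
  ultimately show thesis using that fA by blast
qed

section \<open>A cyclic system of linear equations\<close>

text \<open>The equation \<open>prod_eq\<close> is the vanishing of the determinant of the system
  \<open>l (Suc i) * u (Suc i) = g (Suc i) * u i\<close> on sequences of period \<open>d\<close>. It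
  is stated for every start \<open>j\<close> of a period, so that no product has to be
  rotated.\<close>

locale cyclic_system =
  fixes d :: nat and g l :: "nat \<Rightarrow> complex"
  assumes d: "d > 0"
    and g_periodic: "g (i + d) = g i" and l_periodic: "l (i + d) = l i"
    and prod_eq: "(\<Prod>i\<in>{0<..d}. l (j + i)) = (\<Prod>i\<in>{0<..d}. g (j + i))"

text \<open>Meant for \<open>j < d\<close>: adding \<open>d\<close> keeps the subtraction from being truncated.\<close>

definition cyclic_solution :: "nat \<Rightarrow> (nat \<Rightarrow> complex) \<Rightarrow> (nat \<Rightarrow> complex) \<Rightarrow> nat \<Rightarrow> nat \<Rightarrow> complex" where
  "cyclic_solution d g l j i = (let s = (i + d - j) mod d in
     (\<Prod>r\<in>{0<..s}. g (j + r)) * (\<Prod>r\<in>{s<..d - 1}. l (j + r)))"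

lemma periodic_mod:
  fixes u :: "nat \<Rightarrow> 'a"
  assumes "\<And>i. u (i + d) = u i"
  shows "u (i mod d) = u i"
proof -
  have "u (r + d * n) = u r" for r n
  proof (induction n)
    case (Suc n)
    then show ?case using assms[of "r + d * n"] by (simp add: add_ac)
  qed simp
  then show ?thesis using mod_mult_div_eq[of i d] by metis
qed

lemma periodic_cong:
  fixes u :: "nat \<Rightarrow> 'a"
  assumes "\<And>i. u (i + d) = u i" "i mod d = j mod d"
  shows "u i = u j"
  using periodic_mod[of u d] assms by metis

lemma shift_mod: "j < d \<Longrightarrow> (j + (i + d - j) mod d) mod d = i mod d" for i j d :: nat
  by (simp add: mod_add_right_eq)

lemma cyclic_solution_periodic: "j < d \<Longrightarrow> cyclic_solution d g l j (i + d) = cyclic_solution d g l j i"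
proof -
  assume "j < d"
  then have "(i + d + d - j) mod d = (i + d - j) mod d"
    by (metis Nat.add_diff_assoc2 le_add2 less_imp_le_nat mod_add_self2 trans_le_add2)
  then show ?thesis by (simp add: cyclic_solution_def)
qed

text \<open>The entries at the two ends of the period that starts at \<open>j\<close> are pure
  products: of factors \<open>l\<close> at \<open>j\<close>, and of factors \<open>g\<close> at its
  cyclic predecessor \<open>j + d - 1\<close>.\<close>

lemma cyclic_solution_same: "cyclic_solution d g l j j = (\<Prod>r\<in>{0<..d - 1}. l (j + r))"
  by (simp add: cyclic_solution_def)

lemma cyclic_solution_last:
  "d > 0 \<Longrightarrow> cyclic_solution d g l j (j + d - 1) = (\<Prod>r\<in>{0<..d - 1}. g (j + r))"
proof -
  assume "d > 0"
  then have "j + d - 1 + d - j = (d - 1) + d" by simp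
  then have "(j + d - 1 + d - j) mod d = d - 1"
    using \<open>d > 0\<close> by (simp only: mod_add_self2) simp
  then show ?thesis by (simp add: cyclic_solution_def)
qed

lemma prod_Ioc_Suc: "s \<le> e \<Longrightarrow> (\<Prod>r\<in>{s<..Suc e}. u r) = (\<Prod>r\<in>{s<..e}. u r) * (u (Suc e) :: complex)"
  by (simp add: atLeastSucAtMost_greaterThanAtMost[symmetric] mult.commute)

lemma prod_Ioc_Suc_left: "s < e \<Longrightarrow> (\<Prod>r\<in>{s<..e}. u r) = u (Suc s) * (\<Prod>r\<in>{Suc s<..e}. (u r :: complex))"
  by (metis atLeastSucAtMost_greaterThanAtMost prod.atLeast_Suc_atMost Suc_leI)

context cyclic_system
begin

text \<open>One step along the cycle trades a factor \<open>l\<close> for a factor \<open>g\<close>,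
  so the equations hold identically except at the wrap-around into \<open>j\<close>, where the
  equation is \<open>prod_eq\<close>.\<close>

lemma cyclic_solution_eq:
  assumes j: "j < d"
  shows "l (Suc i) * cyclic_solution d g l j (Suc i) = g (Suc i) * cyclic_solution d g l j i"
proof -
  define s where "s = (i + d - j) mod d"
  have s: "s < d" using d by (simp add: s_def)
  have "Suc (i + d - j) = Suc i + d - j" using j by simp
  then have s': "(Suc i + d - j) mod d = (if Suc s = d then 0 else Suc s)"
    using mod_Suc[of "i + d - j" d] by (simp add: s_def)
  have "(j + s) mod d = i mod d" unfolding s_def by (rule shift_mod[OF j])
  then have "Suc (j + s) mod d = Suc i mod d" by (metis mod_Suc_eq)
  then have "Suc i mod d = (j + Suc s) mod d" by simp
  then have gl: "g (Suc i) = g (j + Suc s)" "l (Suc i) = l (j + Suc s)"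
    by (rule periodic_cong[where u = g, OF g_periodic], rule periodic_cong[where u = l, OF l_periodic])
  show ?thesis
  proof (cases "Suc s = d")
    case True
    have "l (j + d) * (\<Prod>r\<in>{0<..s}. l (j + r)) = g (j + d) * (\<Prod>r\<in>{0<..s}. g (j + r))"
      using prod_eq[of j] unfolding True[symmetric]
      by (simp only: prod_Ioc_Suc[OF le0] mult.commute)
    then show ?thesis
      using True unfolding cyclic_solution_def s' s_def[symmetric] gl by (auto simp: Let_def)
  next
    case False
    have "(\<Prod>r\<in>{s<..d - 1}. l (j + r)) = l (j + Suc s) * (\<Prod>r\<in>{Suc s<..d - 1}. l (j + r))"
      using False s by (intro prod_Ioc_Suc_left) auto
    moreover have "(\<Prod>r\<in>{0<..Suc s}. g (j + r)) = (\<Prod>r\<in>{0<..s}. g (j + r)) * g (j + Suc s)"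
      by (rule prod_Ioc_Suc) simp
    ultimately show ?thesis
      using False unfolding cyclic_solution_def s' s_def[symmetric] gl by (simp add: Let_def)
  qed
qed

context
  fixes u :: "nat \<Rightarrow> complex"
  assumes u: "\<And>i. l (Suc i) * u (Suc i) = g (Suc i) * u i" "\<And>i. u (i + d) = u i"
begin

text \<open>Multiplying consecutive equations avoids dividing by coefficients, any of which may
  vanish.\<close>

lemma solution_transport:
  "s \<le> e \<Longrightarrow> u (j + s) * (\<Prod>r\<in>{s<..e}. g (j + r)) = u (j + e) * (\<Prod>r\<in>{s<..e}. l (j + r))"
proof (induction e rule: dec_induct)
  case (step e)
  have "u (j + s) * (\<Prod>r\<in>{s<..Suc e}. g (j + r)) = u (j + e) * (\<Prod>r\<in>{s<..e}. l (j + r)) * g (j + Suc e)"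
    using step by (simp add: prod_Ioc_Suc)
  also have "\<dots> = (g (Suc (j + e)) * u (j + e)) * (\<Prod>r\<in>{s<..e}. l (j + r))" by simp
  also have "\<dots> = u (j + Suc e) * (\<Prod>r\<in>{s<..Suc e}. l (j + r))"
    using step by (simp add: prod_Ioc_Suc flip: u(1))
  finally show ?case .
qed simp

text \<open>A reference index at one end of the period is joined to every other index by a path that
  avoids the wrap-around into \<open>j\<close>, so transport applies and no division is
  made.\<close>

lemma solution_proportional:
  assumes j: "j < d" and i': "i' = j \<or> i' = j + d - 1"
  shows "u i' * cyclic_solution d g l j i = u i * cyclic_solution d g l j i'"
proof -
  define s where "s = (i + d - j) mod d"
  have s: "s \<le> d - 1" using d by (simp add: s_def less_eq_Suc_le[symmetric] Suc_le_eq flip: less_Suc_eq_le)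
  have "(j + s) mod d = i mod d" unfolding s_def by (rule shift_mod[OF j])
  then have ui: "u i = u (j + s)" using periodic_cong[of u d] u(2) by metis
  have split: "(\<Prod>r\<in>{0<..d - 1}. v (j + r)) = (\<Prod>r\<in>{0<..s}. v (j + r)) * (\<Prod>r\<in>{s<..d - 1}. v (j + r))"
    for v :: "nat \<Rightarrow> complex"
    using s by (subst prod.union_disjoint[symmetric]) (auto intro: prod.cong simp: ivl_disj_un)
  have sol: "cyclic_solution d g l j i = (\<Prod>r\<in>{0<..s}. g (j + r)) * (\<Prod>r\<in>{s<..d - 1}. l (j + r))"
    by (simp add: cyclic_solution_def s_def Let_def)
  from i' show ?thesis
  proof
    assume i': "i' = j"
    show ?thesis using solution_transport[of 0 s j]
      unfolding ui i' cyclic_solution_same sol split by simp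
  next
    assume i': "i' = j + d - 1"
    then have "u i' = u (j + (d - 1))" using d by simp
    then show ?thesis using solution_transport[of s "d - 1" j] s d
      unfolding \<open>u i' = _\<close> ui i' cyclic_solution_last[OF d] sol split by (simp add: mult_ac)
  qed
qed

end

end

section \<open>Cyclic coverings branched over a pulled back Fermat curve\<close>

text \<open>The forms \<open>X\<close>, \<open>Y\<close>, \<open>Z\<close> without common zero
  define a map to the plane along which the branch curve is the pullback of the Fermat curve of
  degree \<open>d\<close>. That \<open>f\<close> is not identically zero makes the complement of the
  branch curve dense.\<close>

locale fermat_cover =
  fixes d k :: nat and X Y Z :: "complex^3 \<Rightarrow> complex" and f :: "complex^3 \<Rightarrow> complex"
  assumes d: "d > 0" and k: "k > 0"
    and forms_XYZ: "X \<in> forms k" "Y \<in> forms k" "Z \<in> forms k"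
    and f_eq: "f v = X v ^ d + Y v ^ d - Z v ^ d"
    and no_common_zero: "v \<noteq> 0 \<Longrightarrow> X v = 0 \<Longrightarrow> Y v = 0 \<Longrightarrow> Z v \<noteq> 0"
    and f_nonzero: "\<exists>v. f v \<noteq> 0"
begin

abbreviation "S \<equiv> bundle_forms k"

sublocale total: graded_ring S
  by (rule bundle_forms_graded_ring[OF k])

lemma f_form: "f \<in> forms (k * d)"
proof -
  have "(\<lambda>v. X v ^ d + Y v ^ d - Z v ^ d) \<in> forms (k * d)"
    by (intro forms.diff forms.add forms.pow forms_XYZ)
  then show ?thesis by (simp add: f_eq[abs_def])
qed

definition mu :: "nat \<Rightarrow> complex" where "mu i = cis (pi / d) * root1 d ^ i"

lemma mu_periodic: "mu (i + d) = mu i"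
  by (simp add: mu_def power_add root1_power[OF d])

lemma mu_power: "mu i ^ d = - 1"
proof -
  have "cis (pi / d) ^ d = - 1" using d by (simp add: Complex.DeMoivre)
  moreover have "(root1 d ^ i) ^ d = 1"
    using root1_power[OF d] by (metis mult.commute power_mult power_one)
  ultimately show ?thesis by (simp add: mu_def power_mult_distrib)
qed

lemma mu_neq: "0 < r \<Longrightarrow> r < d \<Longrightarrow> mu (i + r) \<noteq> mu i"
  using inj_onD[OF inj_root1_power[OF d], of r 0] cis_neq_zero
  by (auto simp: mu_def power_add root1_def)

lemma prod_mu: "(\<Prod>i\<in>{0<..d}. a - mu (j + i) * b) = a ^ d + b ^ d"
proof -
  have "(\<Prod>i\<in>{0<..d}. a - mu (j + i) * b) = (\<Prod>i<d. a - root1 d ^ i * (mu (Suc j) * b))"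
    by (simp add: atLeastSucAtMost_greaterThanAtMost[symmetric] prod.atLeast1_atMost_eq mu_def
        power_add mult_ac)
  also have "\<dots> = a ^ d - (mu (Suc j) * b) ^ d" by (rule prod_root1[OF d])
  finally show ?thesis by (simp add: power_mult_distrib mu_power)
qed

text \<open>At most one of the \<open>d\<close> factors vanishes unless \<open>a = b = 0\<close>,
  because the roots \<open>mu\<close> are distinct. Starting the period at that factor leaves it out
  of the product.\<close>

lemma exists_start:
  assumes "a \<noteq> 0 \<or> b \<noteq> 0"
  shows "\<exists>j<d. (\<Prod>i\<in>{0<..d - 1}. a - mu (j + i) * b) \<noteq> 0"
proof (cases "\<exists>j<d. a = mu j * b")
  case True
  then obtain j where j: "j < d" "a = mu j * b" by blast
  then have "b \<noteq> 0" using assms by auto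
  have "a - mu (j + i) * b \<noteq> 0" if "i \<in> {0<..d - 1}" for i
  proof -
    have "0 < i" "i < d" using that d by auto
    then show ?thesis using \<open>b \<noteq> 0\<close> j mu_neq[of i j] by auto
  qed
  then have "(\<Prod>i\<in>{0<..d - 1}. a - mu (j + i) * b) \<noteq> 0" by simp
  then show ?thesis using j by blast
next
  case False
  have "a - mu (0 + i) * b \<noteq> 0" if "i \<in> {0<..d - 1}" for i
  proof -
    have "i < d" using that d by auto
    then show ?thesis using False by auto
  qed
  then show ?thesis using d by (intro exI[of _ 0]) auto
qed

definition lam :: "nat \<Rightarrow> (complex^3) \<times> complex \<Rightarrow> complex" where
  "lam i c = snd c - mu i * Z (fst c)"

definition gam :: "nat \<Rightarrow> (complex^3) \<times> complex \<Rightarrow> complex" where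
  "gam i c = X (fst c) - mu i * Y (fst c)"

definition on_cover :: "(complex^3) \<times> complex \<Rightarrow> bool" where
  "on_cover c \<longleftrightarrow> snd c ^ d = f (fst c)"

lemma lam_form: "lam i \<in> S k"
  unfolding lam_def[abs_def]
  by (intro total.diff total.scale bundle_forms_pullback k forms_XYZ
      bundle_forms_tautological[unfolded eta_contract_eq])

lemma gam_form: "gam i \<in> S k"
  unfolding gam_def[abs_def]
  by (intro total.diff total.scale bundle_forms_pullback k forms_XYZ)

lemma cyclic_system: "on_cover c \<Longrightarrow> cyclic_system d (\<lambda>i. gam i c) (\<lambda>i. lam i c)"
  by unfold_locales (auto simp: d gam_def lam_def mu_periodic prod_mu on_cover_def f_eq)

text \<open>The \<open>j\<close>-th column of the adjugate of \<open>t - M\<close>, with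
  \<open>i\<close> as the row index.\<close>

definition Phi :: "nat \<Rightarrow> nat \<Rightarrow> (complex^3) \<times> complex \<Rightarrow> complex" where
  "Phi j i c = cyclic_solution d (\<lambda>i. gam i c) (\<lambda>i. lam i c) j i"

lemma Phi_form: "Phi j i \<in> S (k * (d - 1))"
proof -
  define s where "s = (i + d - j) mod d"
  have "(\<lambda>c. (\<Prod>r\<in>{0<..s}. gam (j + r) c) * (\<Prod>r\<in>{s<..d - 1}. lam (j + r) c))
    \<in> S (k * card {0<..s} + k * card {s<..d - 1})"
    by (intro total.mult total.prod gam_form lam_form) auto
  moreover have "s < d" using d by (simp add: s_def)
  then have "s \<le> d - 1" by linarith
  then have "k * card {0<..s} + k * card {s<..d - 1} = k * (d - 1)"
    using d unfolding distrib_left[symmetric] by simp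
  ultimately show ?thesis by (simp add: Phi_def[abs_def] cyclic_solution_def Let_def s_def)
qed

lemma Phi_periodic: "j < d \<Longrightarrow> Phi j (i + d) = Phi j i"
  by (simp add: Phi_def[abs_def] cyclic_solution_periodic)

lemma Phi_eq:
  "on_cover c \<Longrightarrow> j < d \<Longrightarrow> lam (Suc i) c * Phi j (Suc i) c = gam (Suc i) c * Phi j i c"
  unfolding Phi_def by (rule cyclic_system.cyclic_solution_eq[OF cyclic_system])

text \<open>The adjugate vanishes nowhere on the covering. If \<open>t\<close> or \<open>Z\<close>
  is nonzero, at most one \<open>lam\<close> vanishes; otherwise \<open>X\<close> or
  \<open>Y\<close> is nonzero and at most one \<open>gam\<close> vanishes. The nonzero entry found
  lies at an end of a period, as \<open>Phi_proportional\<close> requires.\<close>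

lemma Phi_generates:
  assumes "on_cover c" "fst c \<noteq> 0"
  shows "\<exists>j<d. \<exists>i'\<in>{j, j + d - 1}. Phi j i' c \<noteq> 0"
proof (cases "snd c = 0 \<and> Z (fst c) = 0")
  case True
  then have "X (fst c) ^ d + Y (fst c) ^ d = 0"
    using assms d by (simp add: on_cover_def f_eq zero_power)
  moreover have "X (fst c) \<noteq> 0 \<or> Y (fst c) \<noteq> 0" using True no_common_zero[OF assms(2)] by blast
  ultimately have "\<exists>j<d. (\<Prod>i\<in>{0<..d - 1}. gam (j + i) c) \<noteq> 0"
    using exists_start unfolding gam_def by blast
  then obtain j where "j < d" "(\<Prod>i\<in>{0<..d - 1}. gam (j + i) c) \<noteq> 0"
    by blast
  moreover from this have "Phi j (j + d - 1) c \<noteq> 0"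
    unfolding Phi_def cyclic_solution_last[OF d] by blast
  ultimately show ?thesis by blast
next
  case False
  then obtain j where "j < d" "(\<Prod>i\<in>{0<..d - 1}. lam (j + i) c) \<noteq> 0"
    using exists_start unfolding lam_def by blast
  then show ?thesis
    by (intro exI[of _ j] conjI bexI[of _ j]) (auto simp: Phi_def cyclic_solution_same)
qed

lemma Phi_proportional:
  assumes "on_cover c" "j < d" "i' \<in> {j, j + d - 1}"
    and "\<And>i. lam (Suc i) c * u (Suc i) = gam (Suc i) c * u i" "\<And>i. u (i + d) = u i"
  shows "u i' * Phi j i c = u i * Phi j i' c"
  unfolding Phi_def
  by (rule cyclic_system.solution_proportional[OF cyclic_system[OF assms(1)]]) (use assms in auto)

text \<open>The adjugate of \<open>t - M\<close> is \<open>t ^ (d - 1)\<close> times the identity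
  plus lower terms: an entry at cyclic distance \<open>s\<close> from the diagonal has
  \<open>s\<close> factors \<open>gam\<close>, which are free of \<open>t\<close>, and
  \<open>d - 1 - s\<close> factors monic in \<open>t\<close>.\<close>

lemma Phi_poly:
  assumes "i < d" "j < d"
  shows "\<exists>p. degree p < d \<and> coeff p (d - 1) = (if i = j then 1 else 0) \<and> (\<forall>t. Phi j i (v, t) = poly p t)"
proof -
  define s where "s = (i + d - j) mod d"
  have s: "s < d" using d by (simp add: s_def)
  have s0: "s = 0 \<longleftrightarrow> i = j"
  proof (cases "i \<ge> j")
    case True
    then have "i + d - j = i - j + d" by simp
    then have "s = i - j" using assms by (simp only: s_def mod_add_self2) simp
    then show ?thesis using True by auto
  next
    case False
    then have "s = i + d - j" using assms by (simp add: s_def)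
    then show ?thesis using False assms by auto
  qed
  let ?q = "\<Prod>r\<in>{s<..d - 1}. [:- (mu (j + r) * Z v), 1:]"
  \<comment> \<open>The fibre coordinate 0 is a placeholder, as \<open>gam\<close> depends on the
    plane coordinates only.\<close>
  let ?p = "Polynomial.smult (\<Prod>r\<in>{0<..s}. gam (j + r) (v, 0)) ?q"
  have deg: "degree ?q = d - 1 - s" by (subst degree_prod_eq_sum_degree) auto
  have lead: "lead_coeff ?q = 1" by (simp add: lead_coeff_prod)
  have "degree ?p < d" using deg d by (intro le_less_trans[OF degree_smult_le]) auto
  moreover have "coeff ?p (d - 1) = (if i = j then 1 else 0)"
  proof (cases "s = 0")
    case True
    then show ?thesis using lead deg s0 by simp
  next
    case False
    then have "coeff ?q (d - 1) = 0" using deg s by (intro coeff_eq_0) auto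
    then show ?thesis using False s0 by simp
  qed
  moreover have "Phi j i (v, t) = poly ?p t" for t
    by (simp add: Phi_def cyclic_solution_def Let_def s_def poly_prod lam_def gam_def algebra_simps)
  ultimately show ?thesis by blast
qed

text \<open>A solution without top coefficients satisfies the system as an identity of polynomials.
  Each step against the cycle then raises the degree by one, which is absurd after a full
  period.\<close>

lemma poly_solution_zero:
  assumes deg: "\<And>i. degree (P i) < d" and top: "\<And>i. coeff (P i) (d - 1) = 0"
    and per: "\<And>i. P (i + d) = P i" and v: "f v \<noteq> 0"
    and eq: "\<And>i t. t ^ d = f v \<Longrightarrow> lam (Suc i) (v, t) * poly (P (Suc i)) t = gam (Suc i) (v, t) * poly (P i) t"
  shows "P i = 0"
proof -
  \<comment> \<open>The missing top coefficient leaves room for the linear factor: both sides have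
    degree below \<open>d\<close> and agree at the \<open>d\<close> points of the fibre.\<close>
  have eq': "[:- (mu (Suc i) * Z v), 1:] * P (Suc i) = Polynomial.smult (gam (Suc i) (v, 0)) (P i)" for i
  proof -
    have "degree ([:- (mu (Suc i) * Z v), 1:] * P (Suc i)) < d"
    proof (cases "P (Suc i) = 0")
      case False
      then have "degree (P (Suc i)) \<noteq> d - 1" using top[of "Suc i"] by (metis leading_coeff_0_iff)
      then show ?thesis using deg[of "Suc i"] False by (simp add: degree_mult_eq del: mult_pCons_left)
    qed (use d in simp)
    then have "degree ([:- (mu (Suc i) * Z v), 1:] * P (Suc i) - Polynomial.smult (gam (Suc i) (v, 0)) (P i)) < d"
      using deg[of i] by (intro degree_diff_less) (auto intro: le_less_trans[OF degree_smult_le])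
    then have "[:- (mu (Suc i) * Z v), 1:] * P (Suc i) - Polynomial.smult (gam (Suc i) (v, 0)) (P i) = 0"
    proof (rule poly_eq_0_of_many_roots[OF _ v])
      fix t assume "t ^ d = f v"
      from eq[OF this, of i]
      show "poly ([:- (mu (Suc i) * Z v), 1:] * P (Suc i) - Polynomial.smult (gam (Suc i) (v, 0)) (P i)) t = 0"
        by (simp add: lam_def gam_def algebra_simps)
    qed
    then show ?thesis by simp
  qed
  have "P (i + n) \<noteq> 0 \<Longrightarrow> P i \<noteq> 0 \<and> degree (P i) = n + degree (P (i + n))" for n i
  proof (induction n)
    case (Suc n)
    have "[:- (mu (Suc (i + n)) * Z v), 1:] * P (Suc (i + n)) \<noteq> 0"
      using Suc.prems by (simp del: mult_pCons_left)
    then have "P (i + n) \<noteq> 0" "gam (Suc (i + n)) (v, 0) \<noteq> 0" using eq'[of "i + n"] by auto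
    then have "degree (P (i + n)) = degree ([:- (mu (Suc (i + n)) * Z v), 1:] * P (Suc (i + n)))"
      using eq'[of "i + n"] by simp
    also have "\<dots> = Suc (degree (P (Suc (i + n))))"
      using Suc.prems by (simp add: degree_mult_eq del: mult_pCons_left)
    finally show ?case using Suc.IH \<open>P (i + n) \<noteq> 0\<close> by simp
  qed simp
  from this[of i d] show ?thesis using per[of i] d by auto
qed

section \<open>Reduction modulo the equation of the covering, and norms\<close>

text \<open>Write \<open>j = d q + r\<close> and replace \<open>t ^ j\<close> by
  \<open>f ^ q t ^ r\<close>. Where \<open>k * r\<close> exceeds \<open>m\<close> the truncated
  degree only says that \<open>H r\<close> is constant; the coefficients whose degrees matter later
  satisfy \<open>k * r \<le> m\<close>.\<close>

lemma reduce:
  assumes "F \<in> S m"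
  shows "\<exists>H. (\<forall>r<d. H r \<in> forms (m - k * r)) \<and>
    (\<forall>c. on_cover c \<longrightarrow> F c = (\<Sum>r<d. H r (fst c) * snd c ^ r))"
  using assms
proof (induction rule: bundle_forms_induct[OF k, consumes 1, case_names add monomial])
  case (add a b)
  from add(1) obtain H where H:
    "\<forall>r<d. H r \<in> forms (m - k * r)" "\<forall>c. on_cover c \<longrightarrow> a c = (\<Sum>r<d. H r (fst c) * snd c ^ r)"
    by (elim exE conjE)
  from add(2) obtain G where G:
    "\<forall>r<d. G r \<in> forms (m - k * r)" "\<forall>c. on_cover c \<longrightarrow> b c = (\<Sum>r<d. G r (fst c) * snd c ^ r)"
    by (elim exE conjE)
  from H G show ?case
    by (intro exI[of _ "\<lambda>r v. H r v + G r v"])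
      (auto intro: forms_add simp: distrib_right sum.distrib)
next
  case (monomial h j)
  define q r where "q = j div d" and "r = j mod d"
  have j: "j = d * q + r" by (simp add: q_def r_def)
  have r: "r < d" using d by (simp add: r_def)
  have "(\<lambda>v. h v * f v ^ q) \<in> forms ((m - k * j) + k * d * q)"
    by (intro forms_mult monomial(2) forms.pow f_form)
  moreover have "(m - k * j) + k * d * q = m - k * r"
    using monomial(1) by (simp add: j algebra_simps)
  ultimately have "(\<lambda>v. h v * f v ^ q) \<in> forms (m - k * r)" by simp
  moreover have "(\<Sum>i<d. (if i = r then h v * f v ^ q else 0) * t ^ i) = h v * t ^ j"
    if "on_cover (v, t)" for v t
  proof -
    have "(\<Sum>i<d. (if i = r then h v * f v ^ q else 0) * t ^ i)
      = (\<Sum>i<d. if i = r then h v * f v ^ q * t ^ r else 0)" by (intro sum.cong) auto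
    also have "\<dots> = h v * t ^ j"
      using r that by (simp add: on_cover_def j power_add power_mult)
    finally show ?thesis .
  qed
  moreover have "(\<lambda>v. if i = r then h v * f v ^ q else 0) \<in> forms (m - k * i)" for i
    using calculation(1) forms_zero by (cases "i = r") auto
  ultimately show ?case
    by (intro exI[of _ "\<lambda>i v. if i = r then h v * f v ^ q else 0"]) auto
qed

text \<open>The norm of \<open>B\<close> is the product of its conjugates under the deck
  transformations, and \<open>C\<close> is the product of the conjugates other than \<open>B\<close>
  itself. The norm is invariant, so only its component without \<open>t\<close> survives averaging.
  The product formula shows where it is nonzero.\<close>

lemma norm_form:
  assumes B: "B \<in> S m"
  shows "\<exists>C\<in>S (m * (d - 1)). \<exists>n\<in>forms (m * d). \<forall>c. on_cover c \<longrightarrow>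
    B c * C c = n (fst c) \<and> n (fst c) = (\<Prod>i<d. B (fst c, root1 d ^ i * snd c))"
proof -
  let ?B = "\<lambda>i c. B (fst c, root1 d ^ i * snd c)"
  let ?P = "\<lambda>c. \<Prod>i<d. ?B i c"
  have Bi: "?B i \<in> S m" for i
    using bundle_forms_rotate[OF k B, of "root1 d ^ i"] by (simp add: case_prod_unfold)
  have C: "(\<lambda>c. \<Prod>i\<in>{1..<d}. ?B i c) \<in> S (m * (d - 1))"
    using total.prod[of "{1..<d}" ?B m] Bi by simp
  have "?P \<in> S (m * d)"
    using total.prod[of "{..<d}" ?B m] Bi by simp
  then obtain H where H: "\<And>r. r < d \<Longrightarrow> H r \<in> forms (m * d - k * r)"
    "\<And>c. on_cover c \<Longrightarrow> ?P c = (\<Sum>r<d. H r (fst c) * snd c ^ r)"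
    using reduce by blast
  have rot1: "?P (v, root1 d * t) = ?P (v, t)" for v t
  proof -
    have "?P (v, root1 d * t) = (\<Prod>i<d. ?B (Suc i) (v, t))"
      by (intro prod.cong) (auto simp: algebra_simps)
    moreover have "(\<Prod>i<d. ?B (Suc i) (v, t)) * ?B 0 (v, t) = (\<Prod>i<d. ?B i (v, t)) * ?B d (v, t)"
      using prod.lessThan_Suc_shift[of "\<lambda>i. ?B i (v, t)" d] prod.lessThan_Suc[of "\<lambda>i. ?B i (v, t)" d]
      by (simp add: mult.commute)
    \<comment> \<open>The shift exchanges the factor with index 0 for the one with index
      \<open>d\<close>, and these are equal. They are cancelled if nonzero; otherwise the same zero
      factor occurs in both products.\<close>
    moreover have "(\<Prod>i<d. ?B (Suc i) (v, t)) = (\<Prod>i<d. ?B i (v, t))"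
    proof (cases "B (v, t) = 0")
      case True
      then have "?B 0 (v, t) = 0" "?B (Suc (d - 1)) (v, t) = 0" using d root1_power[OF d] by auto
      then show ?thesis using d by (metis (no_types, lifting) diff_less finite_lessThan lessThan_iff less_numeral_extra(1) prod_zero_iff)
    next
      case False
      then show ?thesis using calculation root1_power[OF d] by simp
    qed
    ultimately show ?thesis by simp
  qed
  have rot: "?P (v, root1 d ^ i * t) = ?P (v, t)" for i v t
    by (induction i) (use rot1 in \<open>auto simp: mult.assoc\<close>)
  have P0: "?P c = H 0 (fst c)" if c: "on_cover c" for c
  proof -
    obtain v t where vt: "c = (v, t)" by force
    have "on_cover (v, root1 d ^ i * t)" for i
    proof -
      have "(root1 d ^ i) ^ d = 1"
        using root1_power[OF d] by (metis mult.commute power_mult power_one)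
      then show ?thesis using c by (simp add: on_cover_def vt power_mult_distrib)
    qed
    \<comment> \<open>The invariant norm is summed over all \<open>d\<close> points
      \<open>root1 d ^ i * t\<close>, so that \<open>sum_root1_power\<close> removes the terms with
      positive \<open>r\<close>.\<close>
    then have "d * ?P (v, t) = (\<Sum>i<d. \<Sum>r<d. H r v * (root1 d ^ i * t) ^ r)"
      using rot[of v _ t] H(2)[of "(v, root1 d ^ i * t)" for i] by simp
    also have "\<dots> = (\<Sum>r<d. \<Sum>i<d. H r v * (root1 d ^ i * t) ^ r)" by (rule sum.swap)
    also have "\<dots> = (\<Sum>r<d. H r v * t ^ r * (\<Sum>i<d. root1 d ^ (i * r)))"
      by (simp add: power_mult_distrib sum_distrib_left mult_ac flip: power_mult)
    also have "\<dots> = (\<Sum>r<d. if r = 0 then H 0 v * d else 0)"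
      using sum_root1_power by (intro sum.cong) auto
    also have "\<dots> = d * H 0 v" using d by simp
    finally show ?thesis using d by (simp add: vt)
  qed
  have "B c * (\<Prod>i\<in>{1..<d}. ?B i c) = ?P c" for c
  proof -
    have "{..<d} = insert 0 {1..<d}" using d by auto
    then show ?thesis by simp
  qed
  then show ?thesis using C H(1)[of 0] d P0
    by (intro bexI[of _ "\<lambda>c. \<Prod>i\<in>{1..<d}. ?B i c"] bexI[of _ "H 0"]) auto
qed

end

section \<open>Representatives of the points\<close>

definition rep :: "(complex^3) set \<Rightarrow> complex^3" where
  "rep y = (SOME v. v \<in> y)"

text \<open>With this choice a form on the plane and its pullback take the same values at the representatives.\<close>

definition bundle_rep :: "((complex^3) \<times> complex) set \<Rightarrow> (complex^3) \<times> complex" where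
  "bundle_rep p = (SOME c. c \<in> p \<and> fst c = rep (bundle_proj p))"

lemma rep_orbit: "rep (orbit (*s) v) \<in> orbit (*s) v"
proof -
  have "v \<in> orbit (*s) v" by (auto simp: orbit_def intro!: exI[of _ 1])
  then show ?thesis unfolding rep_def by (rule someI)
qed

interpretation plane: graded_cone forms plane_cone "(*s)" rep
proof
  show "rep (orbit (*s) c) \<in> plane_cone" if "c \<in> plane_cone" for c
    using rep_orbit[of c] that by (auto simp: orbit_def)
qed (auto simp: forms_homogeneous rep_orbit)

lemma bundle_proj_orbit: "bundle_proj (orbit (bundle_act k) c) = orbit (*s) (fst c)"
  by (force simp: bundle_proj_def orbit_def bundle_act_def case_prod_unfold)

lemma bundle_rep:
  "bundle_rep (orbit (bundle_act k) c) \<in> orbit (bundle_act k) c \<and>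
   fst (bundle_rep (orbit (bundle_act k) c)) = rep (orbit (*s) (fst c))"
proof -
  have "rep (orbit (*s) (fst c)) \<in> fst ` orbit (bundle_act k) c"
    using bundle_proj_orbit[of k c] rep_orbit by (simp add: bundle_proj_def)
  then have "\<exists>c'. c' \<in> orbit (bundle_act k) c \<and> fst c' = rep (bundle_proj (orbit (bundle_act k) c))"
    unfolding bundle_proj_orbit by (metis imageE)
  from someI_ex[OF this] show ?thesis unfolding bundle_rep_def by (simp add: bundle_proj_orbit)
qed

context fermat_cover
begin

sublocale total: graded_cone S bundle_cone "bundle_act k" bundle_rep
proof
  show "bundle_act k 1 c = c" for c by (simp add: bundle_act_def case_prod_unfold)
  show "bundle_act k l (bundle_act k l' c) = bundle_act k (l * l') c" for l l' c
    by (simp add: bundle_act_def case_prod_unfold power_mult_distrib)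
  show "a (bundle_act k l c) = l ^ m * a c" if "a \<in> S m" for a m l c
    using that by (rule bundle_forms_homogeneous[OF k])
  show R: "bundle_rep (orbit (bundle_act k) c) \<in> orbit (bundle_act k) c" for c
    using bundle_rep by blast
  show "bundle_rep (orbit (bundle_act k) c) \<in> bundle_cone" if "c \<in> bundle_cone" for c
    using R[of c] that by (auto simp: orbit_def bundle_act_def)
qed

definition cover :: "((complex^3) \<times> complex) set set" where
  "cover = {p \<in> total.points. on_cover (bundle_rep p)}"

lemma cover_points: "cover \<subseteq> total.points"
  by (auto simp: cover_def)

lemma cover_eq: "zero_locus bundle_cone (bundle_act k) (\<lambda>(v, t). t ^ d - f v) = cover"
proof -
  have "(\<lambda>c. snd c ^ d - f (fst c)) \<in> S (k * d)"
    by (intro total.diff total.pow bundle_forms_pullback k f_form bundle_forms_tautological)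
  from total.zero_locus_eq[OF this] show ?thesis
    by (simp add: cover_def on_cover_def case_prod_unfold)
qed

lemma fst_bundle_rep: "p \<in> total.points \<Longrightarrow> fst (bundle_rep p) = rep (bundle_proj p)"
  using bundle_rep by (force simp: total.points_def bundle_proj_orbit)

text \<open>Only \<open>l = 1\<close> fixes the nonzero vector \<open>rep y\<close>, so prescribing
  the first component of the representative also pins down the fibre coordinate. Every root
  \<open>t\<close> over \<open>rep y\<close> is thus attained without rescaling.\<close>

lemma point_over:
  assumes "y \<in> plane.points"
  obtains p where "p \<in> total.points" "bundle_proj p = y" "bundle_rep p = (rep y, t)"
proof -
  let ?p = "orbit (bundle_act k) (rep y, t)"
  have y: "rep y \<noteq> 0" "orbit (*s) (rep y) = y" using plane.R_in[OF assms] plane.orbit_R[OF assms] by auto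
  then have "?p \<in> total.points" by (intro total.orbit_in_points) simp
  moreover have "bundle_proj ?p = y" by (simp add: bundle_proj_orbit y)
  moreover have "bundle_rep ?p = (rep y, t)"
  proof -
    have *: "bundle_rep ?p \<in> ?p" "fst (bundle_rep ?p) = rep y"
      using bundle_rep[of k "(rep y, t)"] by (simp_all add: y)
    then obtain l where l: "bundle_rep ?p = (l *s rep y, l ^ k * t)"
      by (auto simp: orbit_def bundle_act_def)
    then have "l *s rep y = 1 *s rep y" using * by simp
    then have "l = 1" using y by (simp only: vector_mul_rcancel) simp
    then show ?thesis using l by simp
  qed
  ultimately show thesis by (rule that)
qed

lemma fibre_point:
  assumes "y \<in> plane.points" "t ^ d = f (rep y)"
  obtains p where "p \<in> cover" "bundle_proj p = y" "bundle_rep p = (rep y, t)"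
proof -
  obtain p where "p \<in> total.points" "bundle_proj p = y" "bundle_rep p = (rep y, t)"
    using point_over[OF assms(1)] .
  then show thesis using that assms by (simp add: cover_def on_cover_def)
qed

section \<open>The covering and the plane as varieties\<close>

abbreviation "cov \<equiv> cyclic_cover d k f"

lemma zar_cov: "zar cov = subtopology total.ztop cover"
  by (simp add: cyclic_cover_def closed_subvariety_def cover_eq total_space_def cone_quotient_def)

lemma topspace_cov: "topspace (zar cov) = cover"
  using cover_points by (auto simp: zar_cov total.topspace_cone)

lemma openin_covD:
  assumes "openin (zar cov) U"
  shows "U \<subseteq> cover"
    and "p \<in> U \<Longrightarrow> \<exists>n. \<exists>g\<in>S n. g (bundle_rep p) \<noteq> 0 \<and> (\<forall>q\<in>cover. g (bundle_rep q) \<noteq> 0 \<longrightarrow> q \<in> U)"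
proof -
  obtain W where W: "openin total.ztop W" "U = W \<inter> cover"
    using assms by (auto simp: zar_cov openin_subtopology)
  show "U \<subseteq> cover" using W by simp
  assume "p \<in> U"
  then have "p \<in> W" using W by simp
  then obtain n g where "g \<in> S n" "g (bundle_rep p) \<noteq> 0"
    "\<forall>q\<in>total.points. g (bundle_rep q) \<noteq> 0 \<longrightarrow> q \<in> W"
    using W(1) unfolding total.openin_cone_topology by meson
  then show "\<exists>n. \<exists>g\<in>S n. g (bundle_rep p) \<noteq> 0 \<and> (\<forall>q\<in>cover. g (bundle_rep q) \<noteq> 0 \<longrightarrow> q \<in> U)"
    using W cover_points by blast
qed

lemma openin_cov_basic: "a \<in> S m \<Longrightarrow> openin (zar cov) {p \<in> cover. a (bundle_rep p) \<noteq> 0}"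
  unfolding zar_cov openin_subtopology
  by (intro exI[of _ "{p \<in> total.points. a (bundle_rep p) \<noteq> 0}"] conjI total.openin_basic)
    (use cover_points in auto)

lemma reg_cov:
  "openin (zar cov) U \<Longrightarrow> reg cov U = {\<phi> \<in> extensional U. total.locfrac 0 U (\<lambda>_. \<phi>)}"
  unfolding cyclic_cover_def cover_eq total_space_def
  by (rule total.reg_closed_subvariety[OF cover_points])

lemma zar_plane: "zar proj_plane = plane.ztop"
  by (simp add: proj_plane_def cone_quotient_def)

lemma reg_plane:
  "openin (zar proj_plane) U \<Longrightarrow> reg proj_plane U = {\<phi> \<in> extensional U. plane.locfrac 0 U (\<lambda>_. \<phi>)}"
  unfolding zar_plane unfolding proj_plane_def by (rule plane.reg_cone_quotient)

definition pre :: "(complex^3) set set \<Rightarrow> ((complex^3) \<times> complex) set set" where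
  "pre U = {p \<in> cover. bundle_proj p \<in> U}"

section \<open>The line bundle\<close>

text \<open>
  The kernel of a square matrix of forms of degree \<open>k\<close> that has corank one at every point of the
  covering; its sections are vectors over the twist by \<open>k (d - 1)\<close>, indexed by the integers modulo
  \<open>d\<close>, which are encoded as sequences of period \<open>d\<close>.
\<close>

abbreviation "N \<equiv> k * (d - 1)"

definition sections :: "((complex^3) \<times> complex) set set \<Rightarrow> (nat \<Rightarrow> ((complex^3) \<times> complex) set \<Rightarrow> complex) set" where
  "sections U = {s. (\<forall>i. s i \<in> extensional U) \<and> (\<forall>i. s (i + d) = s i) \<and> total.locfrac N U s \<and>
     (\<forall>i. \<forall>p\<in>U. lam (Suc i) (bundle_rep p) * s (Suc i) p = gam (Suc i) (bundle_rep p) * s i p)}"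

definition ulrich_sheaf :: "((complex^3) \<times> complex) set fun_sheaf" where
  "ulrich_sheaf = \<lparr> sec = (\<lambda>U. \<lparr> carrier = sections U, mult = undefined, one = undefined,
       zero = (\<lambda>i. \<lambda>p\<in>U. 0), add = (\<lambda>s t i. \<lambda>p\<in>U. s i p + t i p),
       smult = (\<lambda>a s i. \<lambda>p\<in>U. a p * s i p) \<rparr>),
     res = (\<lambda>U V s i. restrict (s i) V) \<rparr>"

lemma sectionsI:
  assumes "\<And>i p. p \<in> U \<Longrightarrow> s (i + d) p = s i p" "total.locfrac N U s"
    "\<And>i p. p \<in> U \<Longrightarrow> lam (Suc i) (bundle_rep p) * s (Suc i) p = gam (Suc i) (bundle_rep p) * s i p"
  shows "(\<lambda>i. \<lambda>p\<in>U. s i p) \<in> sections U"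
proof -
  have "total.locfrac N U (\<lambda>i. \<lambda>p\<in>U. s i p)"
    using assms(2) by (subst total.locfrac_cong[of _ _ s]) auto
  moreover have "(\<lambda>p\<in>U. s (i + d) p) = (\<lambda>p\<in>U. s i p)" for i
    using assms(1) by (intro restrict_ext) auto
  ultimately show ?thesis using assms(3) by (simp add: sections_def)
qed

lemma sectionsD:
  assumes "s \<in> sections U"
  shows "restrict (s i) U = s i" "p \<notin> U \<Longrightarrow> s i p = undefined" "s (i + d) = s i"
    "total.locfrac N U s"
    "p \<in> U \<Longrightarrow> lam (Suc i) (bundle_rep p) * s (Suc i) p = gam (Suc i) (bundle_rep p) * s i p"
proof -
  have ext: "s i \<in> extensional U" using assms by (simp add: sections_def)
  show "restrict (s i) U = s i" using ext by (rule extensional_restrict)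
  show "p \<notin> U \<Longrightarrow> s i p = undefined" using ext by (rule extensional_arb)
qed (use assms in \<open>simp_all add: sections_def\<close>)

lemma sections_eqI:
  assumes "s \<in> sections U" "t \<in> sections U" "\<And>i p. p \<in> U \<Longrightarrow> s i p = t i p"
  shows "s = t"
proof (intro ext)
  fix i p
  show "s i p = t i p"
    using assms(3) sectionsD(2)[OF assms(1)] sectionsD(2)[OF assms(2)] by (cases "p \<in> U") simp_all
qed

lemma sections_add:
  assumes "s \<in> sections U" "t \<in> sections U"
  shows "(\<lambda>i. \<lambda>p\<in>U. s i p + t i p) \<in> sections U"
  by (rule sectionsI)
    (use sectionsD[OF assms(1)] sectionsD[OF assms(2)] in \<open>auto simp: total.locfrac_add distrib_left\<close>)

lemma sections_smult:
  assumes "total.locfrac 0 U (\<lambda>_. a)" "s \<in> sections U"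
  shows "(\<lambda>i. \<lambda>p\<in>U. a p * s i p) \<in> sections U"
proof (rule sectionsI)
  show "lam (Suc i) (bundle_rep p) * (a p * s (Suc i) p) = gam (Suc i) (bundle_rep p) * (a p * s i p)"
    if "p \<in> U" for i p
    using sectionsD(5)[OF assms(2) that, of i] by (simp add: mult.left_commute)
qed (use sectionsD[OF assms(2)] assms(1) in \<open>auto simp: total.locfrac_scale_function\<close>)

lemma sections_zero: "(\<lambda>i. \<lambda>p\<in>U. 0) \<in> sections U"
  by (rule sectionsI) (auto simp: total.locfrac_zero)

lemma sections_restrict:
  assumes "s \<in> sections U" "V \<subseteq> U"
  shows "(\<lambda>i. restrict (s i) V) \<in> sections V"
  by (rule sectionsI)
    (use sectionsD[OF assms(1)] assms(2) in \<open>auto intro: total.locfrac_subset\<close>)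

lemma module_ulrich_sheaf:
  assumes U: "openin (zar cov) U"
  shows "Module.module (reg_ring cov U) (sec ulrich_sheaf U)"
proof (rule moduleI)
  show "cring (reg_ring cov U)" by (rule total.cring_reg_ring[OF reg_cov[OF U]])
  show "abelian_group (sec ulrich_sheaf U)"
  proof (rule abelian_groupI)
    fix s assume s: "s \<in> carrier (sec ulrich_sheaf U)"
    have "total.locfrac 0 U (\<lambda>_ _. - 1)" by (rule total.locfrac_const)
    from sections_smult[OF this, of s] show "\<exists>t\<in>carrier (sec ulrich_sheaf U). t \<oplus>\<^bsub>sec ulrich_sheaf U\<^esub> s = \<zero>\<^bsub>sec ulrich_sheaf U\<^esub>"
      using s by (intro bexI[of _ "\<lambda>i. \<lambda>p\<in>U. - 1 * s i p"]) (auto simp: ulrich_sheaf_def fun_eq_iff)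
  qed (auto simp: ulrich_sheaf_def sections_add sections_zero fun_eq_iff sectionsD)
qed (auto simp: ulrich_sheaf_def reg_ring_def reg_cov[OF U] sections_smult fun_eq_iff sectionsD distrib_left distrib_right)

text \<open>Sections are tuples of functions and the equations are pointwise, so the values glue at
  once; being a local fraction glues by \<open>locfrac_local\<close>.\<close>

lemma module_sheaf_ulrich_sheaf: "module_sheaf cov ulrich_sheaf"
proof (rule module_sheaf.intro)
  fix U assume U: "openin (zar cov) U"
  show "Module.module (reg_ring cov U) (sec ulrich_sheaf U)" by (rule module_ulrich_sheaf[OF U])
next
  fix \<U> s t
  assume s: "s \<in> carrier (sec ulrich_sheaf (\<Union>\<U>))" and t: "t \<in> carrier (sec ulrich_sheaf (\<Union>\<U>))"
    and eq: "\<forall>V\<in>\<U>. res ulrich_sheaf (\<Union>\<U>) V s = res ulrich_sheaf (\<Union>\<U>) V t"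
  show "s = t"
  proof (rule sections_eqI)
    show "s \<in> sections (\<Union>\<U>)" "t \<in> sections (\<Union>\<U>)" using s t by (auto simp: ulrich_sheaf_def)
    fix i p assume "p \<in> \<Union>\<U>"
    then obtain V where V: "V \<in> \<U>" "p \<in> V" by blast
    then have "(\<lambda>i. restrict (s i) V) = (\<lambda>i. restrict (t i) V)" using eq by (simp add: ulrich_sheaf_def)
    then have "restrict (s i) V p = restrict (t i) V p" by metis
    then show "s i p = t i p" using V by simp
  qed
next
  fix \<U> g
  assume open': "\<forall>V\<in>\<U>. openin (zar cov) V" and g: "\<forall>V\<in>\<U>. g V \<in> carrier (sec ulrich_sheaf V)"
    and compat: "\<forall>V\<in>\<U>. \<forall>W\<in>\<U>. res ulrich_sheaf V (V \<inter> W) (g V) = res ulrich_sheaf W (V \<inter> W) (g W)"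
  define s where "s = (\<lambda>i p. g (SOME V. V \<in> \<U> \<and> p \<in> V) i p)"
  have gs: "g V \<in> sections V" if "V \<in> \<U>" for V using g that by (auto simp: ulrich_sheaf_def)
  have s: "s i p = g V i p" if V: "V \<in> \<U>" "p \<in> V" for V i p
  proof -
    define W where "W = (SOME V. V \<in> \<U> \<and> p \<in> V)"
    have W: "W \<in> \<U>" "p \<in> W" using someI[of "\<lambda>V. V \<in> \<U> \<and> p \<in> V" V] V by (auto simp: W_def)
    have "(\<lambda>i. restrict (g V i) (V \<inter> W)) = (\<lambda>i. restrict (g W i) (V \<inter> W))"
      using bspec[OF bspec[OF compat V(1)] W(1)] by (simp add: ulrich_sheaf_def)
    then have "restrict (g V i) (V \<inter> W) p = restrict (g W i) (V \<inter> W) p" by metis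
    then show ?thesis using V W by (simp add: s_def W_def)
  qed
  have "(\<lambda>i. \<lambda>p\<in>\<Union>\<U>. s i p) \<in> sections (\<Union>\<U>)"
  proof (rule sectionsI)
    fix i p assume "p \<in> \<Union>\<U>"
    then obtain V where V: "V \<in> \<U>" "p \<in> V" by blast
    show "s (i + d) p = s i p"
      "lam (Suc i) (bundle_rep p) * s (Suc i) p = gam (Suc i) (bundle_rep p) * s i p"
      using sectionsD(3,5)[OF gs[OF V(1)]] s[OF V] V by auto
  next
    show "total.locfrac N (\<Union>\<U>) s"
    proof (rule total.locfrac_local)
      fix p assume "p \<in> \<Union>\<U>"
      then obtain V where V: "V \<in> \<U>" "p \<in> V" by blast
      have oV: "openin (zar cov) V" using open' V by blast
      have "total.locfrac N V s"
        using sectionsD(4)[OF gs[OF V(1)]] s[OF V(1)] by (subst total.locfrac_cong[of _ _ "g V"]) auto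
      moreover obtain n h where "h \<in> S n" "h (bundle_rep p) \<noteq> 0"
        "\<forall>q\<in>cover. h (bundle_rep q) \<noteq> 0 \<longrightarrow> q \<in> V"
        using openin_covD(2)[OF oV V(2)] by blast
      moreover have "\<Union>\<U> \<subseteq> cover" using open' openin_covD(1) by blast
      ultimately show "\<exists>V. p \<in> V \<and> V \<subseteq> \<Union>\<U> \<and> total.locfrac N V s \<and>
        (\<exists>n. \<exists>g\<in>S n. g (bundle_rep p) \<noteq> 0 \<and> (\<forall>q\<in>\<Union>\<U>. g (bundle_rep q) \<noteq> 0 \<longrightarrow> q \<in> V))"
        using V by blast
    qed
  qed
  moreover have "(\<lambda>i. restrict (\<lambda>p\<in>\<Union>\<U>. s i p) V) = g V" if V: "V \<in> \<U>" for V
    using s[OF V] sectionsD(2)[OF gs[OF V]] V by (auto simp: fun_eq_iff restrict_def)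
  ultimately show "\<exists>s\<in>carrier (sec ulrich_sheaf (\<Union>\<U>)). \<forall>V\<in>\<U>. res ulrich_sheaf (\<Union>\<U>) V s = g V"
    by (intro bexI[of _ "\<lambda>i. \<lambda>p\<in>\<Union>\<U>. s i p"]) (auto simp: ulrich_sheaf_def)
qed (auto simp: ulrich_sheaf_def sections_restrict fun_eq_iff sectionsD subset_iff)

lemma cover_cone: "p \<in> cover \<Longrightarrow> on_cover (bundle_rep p) \<and> fst (bundle_rep p) \<noteq> 0"
  using total.R_in[of p] by (auto simp: cover_def)

lemma Phi_section:
  assumes "U \<subseteq> cover" "j < d" "total.locfrac 0 U (\<lambda>_. a)"
  shows "(\<lambda>i. \<lambda>p\<in>U. a p * Phi j i (bundle_rep p)) \<in> sections U"
proof (rule sectionsI)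
  show "total.locfrac N U (\<lambda>i p. a p * Phi j i (bundle_rep p))"
    by (intro total.locfrac_scale_function assms total.locfrac_form Phi_form)
  show "lam (Suc i) (bundle_rep p) * (a p * Phi j (Suc i) (bundle_rep p))
      = gam (Suc i) (bundle_rep p) * (a p * Phi j i (bundle_rep p))" if "p \<in> U" for i p
    using Phi_eq[of "bundle_rep p" j i] cover_cone[of p] assms that by (auto simp: mult.left_commute)
qed (simp add: Phi_periodic assms)

text \<open>Where the entry \<open>i'\<close> of \<open>Phi j\<close> is nonzero, every solution
  \<open>s\<close> is the multiple of \<open>Phi j\<close> by \<open>s i' / Phi j i'\<close>. Both
  have the same twist, so this ratio is a regular function.\<close>

lemma locally_free_ulrich_sheaf:
  assumes x: "x \<in> cover"
  shows "\<exists>W. openin (zar cov) W \<and> x \<in> W \<and> isomorphic_over cov W ulrich_sheaf (free_sheaf cov 1)"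
proof -
  obtain j i' where ji: "j < d" "i' \<in> {j, j + d - 1}" "Phi j i' (bundle_rep x) \<noteq> 0"
    using Phi_generates cover_cone[OF x] by metis
  define W where "W = {p \<in> cover. Phi j i' (bundle_rep p) \<noteq> 0}"
  have W: "openin (zar cov) W" unfolding W_def by (rule openin_cov_basic[OF Phi_form])
  define \<phi> where "\<phi> = (\<lambda>U (s :: nat \<Rightarrow> ((complex^3) \<times> complex) set \<Rightarrow> complex).
    \<lambda>l\<in>{..<1::nat}. \<lambda>p\<in>U. s i' p / Phi j i' (bundle_rep p))"
  define \<psi> where "\<psi> = (\<lambda>U (a :: nat \<Rightarrow> ((complex^3) \<times> complex) set \<Rightarrow> complex) i.
    \<lambda>p\<in>U. a 0 p * Phi j i (bundle_rep p))"
  have "isomorphic_over cov W ulrich_sheaf (free_sheaf cov 1)"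
    unfolding isomorphic_over_def
  proof (intro exI[of _ \<phi>] conjI allI impI ballI; (elim conjE)?)
    fix U assume oU: "openin (zar cov) U" and UW: "U \<subseteq> W"
    have nz: "Phi j i' (bundle_rep p) \<noteq> 0" "p \<in> cover" if "p \<in> U" for p
      using that UW by (auto simp: W_def)
    show "bij_betw (\<phi> U) (carrier (sec ulrich_sheaf U)) (carrier (sec (free_sheaf cov 1) U))"
    proof (rule bij_betw_byWitness[where f' = "\<psi> U"])
      show "\<forall>s\<in>carrier (sec ulrich_sheaf U). \<psi> U (\<phi> U s) = s"
      proof
        fix s assume "s \<in> carrier (sec ulrich_sheaf U)"
        then have s: "s \<in> sections U" by (simp add: ulrich_sheaf_def)
        have "s i' p / Phi j i' (bundle_rep p) * Phi j i (bundle_rep p) = s i p" if "p \<in> U" for i p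
        proof -
          have "s i' p * Phi j i (bundle_rep p) = s i p * Phi j i' (bundle_rep p)"
            using sectionsD(3,5)[OF s] that cover_cone[OF nz(2)[OF that]] ji
            by (intro Phi_proportional[where u = "\<lambda>i. s i p"]) auto
          then show ?thesis using nz[OF that] by (simp add: field_simps)
        qed
        then show "\<psi> U (\<phi> U s) = s"
          using sectionsD(2)[OF s] by (auto simp: \<psi>_def \<phi>_def fun_eq_iff restrict_def)
      qed
      show "\<forall>a\<in>carrier (sec (free_sheaf cov 1) U). \<phi> U (\<psi> U a) = a"
      proof
        fix a assume "a \<in> carrier (sec (free_sheaf cov 1) U)"
        then have a: "a \<in> {..<1} \<rightarrow>\<^sub>E reg cov U" by (simp add: free_sheaf_def)
        then have "a 0 \<in> extensional U" "\<And>i. i > 0 \<Longrightarrow> a i = undefined"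
          by (auto simp: reg_cov[OF oU] PiE_def extensional_def)
        then show "\<phi> U (\<psi> U a) = a"
          using nz by (auto simp: \<psi>_def \<phi>_def fun_eq_iff extensional_def)
      qed
      show "\<phi> U ` carrier (sec ulrich_sheaf U) \<subseteq> carrier (sec (free_sheaf cov 1) U)"
      proof (intro image_subsetI)
        fix s assume "s \<in> carrier (sec ulrich_sheaf U)"
        then have "total.locfrac N U s" using sectionsD(4) by (simp add: ulrich_sheaf_def)
        then have "total.locfrac 0 U (\<lambda>i p. s i p / Phi j i' (bundle_rep p))"
          using nz(1) by (rule total.locfrac_divide[OF _ Phi_form])
        then have "total.locfrac 0 U (\<lambda>_. \<lambda>p\<in>U. s i' p / Phi j i' (bundle_rep p))"
          using total.locfrac_component[of 0 U _ i']
          by (subst total.locfrac_cong[of _ _ "\<lambda>_ p. s i' p / Phi j i' (bundle_rep p)"]) auto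
        then show "\<phi> U s \<in> carrier (sec (free_sheaf cov 1) U)"
          by (auto simp: free_sheaf_def \<phi>_def reg_cov[OF oU])
      qed
      show "\<psi> U ` carrier (sec (free_sheaf cov 1) U) \<subseteq> carrier (sec ulrich_sheaf U)"
        using Phi_section[OF _ ji(1)] openin_covD(1)[OF oU]
        by (auto simp: free_sheaf_def \<psi>_def reg_cov[OF oU] ulrich_sheaf_def)
    qed
    show "\<phi> U (s \<oplus>\<^bsub>sec ulrich_sheaf U\<^esub> t) = \<phi> U s \<oplus>\<^bsub>sec (free_sheaf cov 1) U\<^esub> \<phi> U t" for s t
      by (auto simp: \<phi>_def ulrich_sheaf_def free_sheaf_def reg_ring_def fun_eq_iff add_divide_distrib)
    show "\<phi> U (a \<odot>\<^bsub>sec ulrich_sheaf U\<^esub> s) = a \<odot>\<^bsub>sec (free_sheaf cov 1) U\<^esub> \<phi> U s" for a s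
      by (auto simp: \<phi>_def ulrich_sheaf_def free_sheaf_def reg_ring_def fun_eq_iff)
  next
    fix U V :: "((complex^3) \<times> complex) set set" and s assume "V \<subseteq> U"
    then show "\<phi> V (res ulrich_sheaf U V s) = res (free_sheaf cov 1) U V (\<phi> U s)"
      by (auto simp: \<phi>_def ulrich_sheaf_def free_sheaf_def fun_eq_iff)
  qed
  then show ?thesis using W x ji by (auto simp: W_def)
qed

lemma vector_bundle_ulrich_sheaf: "vector_bundle cov 1 ulrich_sheaf"
  using module_sheaf_ulrich_sheaf locally_free_ulrich_sheaf by (simp add: vector_bundle_def topspace_cov)

end

lemma bundle_forms_zero_section:
  assumes k: "k > 0" and "F \<in> bundle_forms k m"
  shows "(\<lambda>v. F (v, 0)) \<in> forms m"
  using assms(2)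
proof (induction rule: bundle_forms_induct[OF k, consumes 1, case_names add monomial])
  case (add a b)
  then show ?case by (rule forms_add)
next
  case (monomial h j)
  then show ?case by (cases "j = 0") (auto simp: forms_zero zero_power)
qed

lemma sum_power_0: "n > 0 \<Longrightarrow> (\<Sum>r<n. a r * 0 ^ r) = (a 0 :: complex)"
  by (cases n) (simp_all add: sum.lessThan_Suc_shift)

text \<open>The explicit map \<open>expand\<close> goes from the free sheaf to the direct image,
  against the direction demanded of Ulrich bundles. The closure conditions on \<open>N\<close> place
  sums, multiples and restrictions in the domain of the inverse.\<close>

lemma isomorphic_over_sym:
  assumes iso: "\<And>U. openin (zar X) U \<Longrightarrow> U \<subseteq> W \<Longrightarrow> bij_betw (\<psi> U) (carrier (sec N U)) (carrier (sec M U))"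
    and add: "\<And>U s t. openin (zar X) U \<Longrightarrow> U \<subseteq> W \<Longrightarrow> s \<in> carrier (sec N U) \<Longrightarrow> t \<in> carrier (sec N U) \<Longrightarrow>
      s \<oplus>\<^bsub>sec N U\<^esub> t \<in> carrier (sec N U) \<and> \<psi> U (s \<oplus>\<^bsub>sec N U\<^esub> t) = \<psi> U s \<oplus>\<^bsub>sec M U\<^esub> \<psi> U t"
    and smult: "\<And>U a s. openin (zar X) U \<Longrightarrow> U \<subseteq> W \<Longrightarrow> a \<in> reg X U \<Longrightarrow> s \<in> carrier (sec N U) \<Longrightarrow>
      a \<odot>\<^bsub>sec N U\<^esub> s \<in> carrier (sec N U) \<and> \<psi> U (a \<odot>\<^bsub>sec N U\<^esub> s) = a \<odot>\<^bsub>sec M U\<^esub> \<psi> U s"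
    and res: "\<And>U V s. openin (zar X) U \<Longrightarrow> openin (zar X) V \<Longrightarrow> V \<subseteq> U \<Longrightarrow> U \<subseteq> W \<Longrightarrow>
      s \<in> carrier (sec N U) \<Longrightarrow>
      res N U V s \<in> carrier (sec N V) \<and> \<psi> V (res N U V s) = res M U V (\<psi> U s)"
  shows "isomorphic_over X W M N"
  unfolding isomorphic_over_def
proof (intro exI[of _ "\<lambda>U. inv_into (carrier (sec N U)) (\<psi> U)"] conjI allI impI ballI; (elim conjE)?)
  fix U assume U: "openin (zar X) U" "U \<subseteq> W"
  let ?\<phi> = "inv_into (carrier (sec N U)) (\<psi> U)"
  have \<phi>: "?\<phi> s \<in> carrier (sec N U)" "\<psi> U (?\<phi> s) = s" if "s \<in> carrier (sec M U)" for s
    using iso[OF U] that by (auto simp: bij_betw_def inv_into_into f_inv_into_f)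
  have \<phi>': "?\<phi> (\<psi> U s) = s" if "s \<in> carrier (sec N U)" for s
    using iso[OF U] that by (auto simp: bij_betw_def)
  show "bij_betw ?\<phi> (carrier (sec M U)) (carrier (sec N U))"
    using iso[OF U] by (rule bij_betw_inv_into)
  show "?\<phi> (s \<oplus>\<^bsub>sec M U\<^esub> t) = ?\<phi> s \<oplus>\<^bsub>sec N U\<^esub> ?\<phi> t"
    if s: "s \<in> carrier (sec M U)" and t: "t \<in> carrier (sec M U)" for s t
    using add[OF U \<phi>(1)[OF s] \<phi>(1)[OF t]] \<phi>(2)[OF s] \<phi>(2)[OF t] \<phi>' by metis
  show "?\<phi> (a \<odot>\<^bsub>sec M U\<^esub> s) = a \<odot>\<^bsub>sec N U\<^esub> ?\<phi> s"
    if a: "a \<in> reg X U" and s: "s \<in> carrier (sec M U)" for a s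
    using smult[OF U a \<phi>(1)[OF s]] \<phi>(2)[OF s] \<phi>' by metis
next
  fix U V s assume UV: "openin (zar X) U" "openin (zar X) V" "V \<subseteq> U" "U \<subseteq> W"
    and s: "s \<in> carrier (sec M U)"
  have VW: "V \<subseteq> W" using UV by blast
  have 1: "inv_into (carrier (sec N U)) (\<psi> U) s \<in> carrier (sec N U)"
    "\<psi> U (inv_into (carrier (sec N U)) (\<psi> U) s) = s"
    using iso[OF UV(1,4)] s by (auto simp: bij_betw_def inv_into_into f_inv_into_f)
  have 2: "inv_into (carrier (sec N V)) (\<psi> V) (\<psi> V t) = t" if "t \<in> carrier (sec N V)" for t
    using iso[OF UV(2) VW] that by (auto simp: bij_betw_def)
  show "inv_into (carrier (sec N V)) (\<psi> V) (res M U V s) = res N U V (inv_into (carrier (sec N U)) (\<psi> U) s)"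
    using res[OF UV 1(1)] 1(2) 2 by metis
qed

context fermat_cover
begin

section \<open>The direct image\<close>

lemma f_at_0: "f 0 = 0"
  using forms_homogeneous[OF f_form, of 0 "0::complex^3"] d k by (simp add: zero_power)

text \<open>Density of the complement of the branch curve: \<open>F g f\<close> vanishes at all
  representatives, hence everywhere by homogeneity, and \<open>f\<close> can be cancelled.\<close>

lemma form_zero_of_zero_off_branch:
  assumes F: "F \<in> forms m" and g: "g \<in> forms n" "g v \<noteq> 0"
    and zero: "\<And>y. y \<in> plane.points \<Longrightarrow> g (rep y) \<noteq> 0 \<Longrightarrow> f (rep y) \<noteq> 0 \<Longrightarrow> F (rep y) = 0"
  shows "F v = 0"
proof -
  have all: "(F v * g v) * f v = 0" for v
  proof (cases "v = 0")
    case False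
    then have v: "v \<in> plane_cone" by simp
    obtain l where l: "v = l *s rep (orbit (*s) v)" using plane.R_act[OF v] by blast
    have "(F u * g u) * f u = 0" if "u = rep (orbit (*s) v)" for u
      using zero[OF plane.orbit_in_points[OF v]] that by auto
    moreover have "(F v * g v) * f v = l ^ (m + n + k * d) * ((F u * g u) * f u)" if "u = rep (orbit (*s) v)" for u
      using forms_homogeneous[OF forms_mult[OF forms_mult[OF F g(1)] f_form], of l u] l that by metis
    ultimately show ?thesis by simp
  qed (simp add: f_at_0)
  obtain w where w: "f w \<noteq> 0" using f_nonzero by blast
  have "F u * g u = 0" for u
    by (rule forms_no_zero_divisors[OF forms_mult[OF F g(1)] f_form all w])
  then show ?thesis using g(2) by (metis mult_eq_0_iff)
qed

lemma regular_zero_of_zero_off_branch: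
  assumes U: "openin (zar proj_plane) U" and a: "plane.locfrac 0 U (\<lambda>_. a)"
    and zero: "\<And>y. y \<in> U \<Longrightarrow> f (rep y) \<noteq> 0 \<Longrightarrow> a y = 0" and y: "y \<in> U"
  shows "a y = 0"
proof -
  obtain m b c where 1: "b \<in> forms m" "b (rep y) \<noteq> 0" "\<And>i::nat. c i \<in> forms (m + 0)"
    "\<And>i q. q \<in> U \<Longrightarrow> a q * b (rep q) = c i (rep q)"
    using plane.locfracE[OF a y] by metis
  obtain n g where g: "g \<in> forms n" "g (rep y) \<noteq> 0" "\<forall>q\<in>plane.points. g (rep q) \<noteq> 0 \<longrightarrow> q \<in> U"
    using U y unfolding zar_plane plane.openin_cone_topology by blast
  have "c 0 (rep y) = 0"
  proof (rule form_zero_of_zero_off_branch[OF 1(3) g(1,2)])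
    fix q assume "q \<in> plane.points" "g (rep q) \<noteq> 0" "f (rep q) \<noteq> 0"
    then show "c 0 (rep q) = 0" using zero[of q] g(3) 1(4)[of q 0] by auto
  qed
  then show ?thesis using 1(2) 1(4)[OF y, of 0] by auto
qed

text \<open>The combination of the columns of the adjugate with coefficients pulled back from the
  plane, that is, the section with prescribed coefficients of \<open>t ^ (d - 1)\<close>.\<close>

definition expand :: "(complex^3) set set \<Rightarrow> (nat \<Rightarrow> (complex^3) set \<Rightarrow> complex) \<Rightarrow>
    nat \<Rightarrow> ((complex^3) \<times> complex) set \<Rightarrow> complex" where
  "expand U h = (\<lambda>i. \<lambda>p\<in>pre U. \<Sum>j<d. h j (bundle_proj p) * Phi j i (bundle_rep p))"

lemma pullback_locfrac:
  assumes "plane.locfrac 0 U (\<lambda>_. a)"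
  shows "total.locfrac 0 (pre U) (\<lambda>_ p. a (bundle_proj p))"
proof (rule total.locfracI)
  fix p assume p: "p \<in> pre U"
  have fr: "fst (bundle_rep q) = rep (bundle_proj q)" "bundle_proj q \<in> U" if "q \<in> pre U" for q
    using that cover_points fst_bundle_rep by (auto simp: pre_def)
  obtain m b c where 1: "b \<in> forms m" "b (rep (bundle_proj p)) \<noteq> 0" "\<And>i::nat. c i \<in> forms (m + 0)"
    "\<And>i q. q \<in> U \<Longrightarrow> a q * b (rep q) = c i (rep q)"
    using plane.locfracE[OF assms fr(2)[OF p]] by metis
  show "\<exists>m b c. b \<in> S m \<and> b (bundle_rep p) \<noteq> 0 \<and> (\<forall>i. c i \<in> S (m + 0)) \<and>
    (\<forall>i. \<forall>q\<in>pre U. a (bundle_proj q) * b (bundle_rep q) = c (i::nat) (bundle_rep q))"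
    by (rule exI[of _ m], rule exI[of _ "\<lambda>c. b (fst c)"], rule exI[of _ "\<lambda>i x. c i (fst x)"])
      (use 1 p bundle_forms_pullback[OF k] in \<open>auto simp: fr\<close>)
qed

lemma expand_section:
  assumes "\<And>j. j < d \<Longrightarrow> plane.locfrac 0 U (\<lambda>_. h j)"
  shows "expand U h \<in> sections (pre U)"
  unfolding expand_def
proof (rule sectionsI)
  show "total.locfrac N (pre U) (\<lambda>i p. \<Sum>j<d. h j (bundle_proj p) * Phi j i (bundle_rep p))"
    by (intro total.locfrac_sum total.locfrac_scale_function pullback_locfrac assms
        total.locfrac_form Phi_form) simp
  fix i p assume "p \<in> pre U"
  then have "on_cover (bundle_rep p)" by (simp add: pre_def cover_def)
  then show "lam (Suc i) (bundle_rep p) * (\<Sum>j<d. h j (bundle_proj p) * Phi j (Suc i) (bundle_rep p))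
    = gam (Suc i) (bundle_rep p) * (\<Sum>j<d. h j (bundle_proj p) * Phi j i (bundle_rep p))"
    unfolding sum_distrib_left using Phi_eq by (intro sum.cong) (auto simp: mult.left_commute)
qed (simp add: Phi_periodic)

lemma expand_poly:
  assumes "i < d"
  shows "\<exists>p. degree p < d \<and> coeff p (d - 1) = a i \<and> (\<forall>t. (\<Sum>j<d. a j * Phi j i (v, t)) = poly p t)"
proof -
  obtain q where q: "\<And>j. j < d \<Longrightarrow> degree (q j) < d" "\<And>j. j < d \<Longrightarrow> coeff (q j) (d - 1) = (if i = j then 1 else 0)"
    "\<And>j t. j < d \<Longrightarrow> Phi j i (v, t) = poly (q j) t"
    using Phi_poly[OF assms, of _ v] by metis
  let ?p = "\<Sum>j<d. Polynomial.smult (a j) (q j)"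
  have "degree ?p < d"
    using q(1) d by (intro degree_sum_less) (auto intro: le_less_trans[OF degree_smult_le])
  moreover have "coeff ?p (d - 1) = a i"
  proof -
    have "coeff ?p (d - 1) = (\<Sum>j<d. if j = i then a i else 0)"
      unfolding coeff_sum using q(2) by (intro sum.cong) auto
    then show ?thesis using assms by simp
  qed
  moreover have "(\<Sum>j<d. a j * Phi j i (v, t)) = poly ?p t" for t
    using q(3) by (simp add: poly_sum)
  ultimately show ?thesis by blast
qed

text \<open>Off the branch curve the \<open>d\<close> points of the fibre determine a polynomial of
  degree below \<open>d\<close>, whose top coefficient is the difference of the two coefficient
  functions. Density covers the rest.\<close>

lemma expand_inj:
  assumes U: "openin (zar proj_plane) U"
    and h: "\<And>j. j < d \<Longrightarrow> plane.locfrac 0 U (\<lambda>_. h j)" and h': "\<And>j. j < d \<Longrightarrow> plane.locfrac 0 U (\<lambda>_. h' j)"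
    and eq: "expand U h = expand U h'" and i: "i < d" and y: "y \<in> U"
  shows "h i y = h' i y"
proof -
  have "h i y - h' i y = 0"
  proof (rule regular_zero_of_zero_off_branch[OF U _ _ y, where a = "\<lambda>y. h i y - h' i y"])
    show "plane.locfrac 0 U (\<lambda>_ y. h i y - h' i y)"
      using plane.locfrac_add[OF h[OF i] plane.locfrac_scale_function[OF plane.locfrac_const[of U "\<lambda>_. -1"] h'[OF i]]]
      by simp
    fix z assume z: "z \<in> U" "f (rep z) \<noteq> 0"
    have zp: "z \<in> plane.points" using U z unfolding zar_plane plane.openin_cone_topology by blast
    obtain p where p: "degree p < d" "coeff p (d - 1) = h i z - h' i z"
      "\<And>t. (\<Sum>j<d. (h j z - h' j z) * Phi j i (rep z, t)) = poly p t"
      using expand_poly[OF i, of "\<lambda>j. h j z - h' j z" "rep z"] by blast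
    have "p = 0"
    proof (rule poly_eq_0_of_many_roots[OF p(1) z(2)])
      fix t assume "t ^ d = f (rep z)"
      from fibre_point[OF zp this] obtain x where
        x: "x \<in> cover" "bundle_proj x = z" "bundle_rep x = (rep z, t)" .
      then have "x \<in> pre U" using z by (simp add: pre_def)
      then have "(\<Sum>j<d. h j z * Phi j i (rep z, t)) = (\<Sum>j<d. h' j z * Phi j i (rep z, t))"
        using fun_cong[OF fun_cong[OF eq, of i], of x] x by (simp add: expand_def)
      then show "poly p t = 0" unfolding p(3)[symmetric]
        by (simp add: left_diff_distrib sum_subtractf)
    qed
    then show "h i z - h' i z = 0" using p(2) by simp
  qed
  then show ?thesis by simp
qed

section \<open>Surjectivity of the trivialisation\<close>

lemma finite_fibre: "finite {p \<in> cover. bundle_proj p = y}"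
proof (rule inj_on_finite)
  show "inj_on (\<lambda>p. snd (bundle_rep p)) {p \<in> cover. bundle_proj p = y}"
  proof (rule inj_onI)
    fix p q assume p: "p \<in> {p \<in> cover. bundle_proj p = y}" and q: "q \<in> {p \<in> cover. bundle_proj p = y}"
      and eq: "snd (bundle_rep p) = snd (bundle_rep q)"
    moreover have "p \<in> total.points" "q \<in> total.points" using p q cover_points by auto
    ultimately have "bundle_rep p = bundle_rep q"
      using fst_bundle_rep[of p] fst_bundle_rep[of q] by (simp add: prod_eq_iff)
    then show "p = q" using total.orbit_R[of p] total.orbit_R[of q] p q cover_points by auto
  qed
  show "(\<lambda>p. snd (bundle_rep p)) ` {p \<in> cover. bundle_proj p = y} \<subseteq> {t. t ^ d = f (rep y)}"
    using fst_bundle_rep cover_points by (auto simp: cover_def on_cover_def)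
  show "finite {t. t ^ d = f (rep y)}" using finite_nth_roots[OF d] .
qed

text \<open>Clear denominators with a form that is nonzero on the whole fibre, and replace it by its norm.\<close>

lemma sections_polynomial:
  assumes U: "openin (zar proj_plane) U" and s: "total.locfrac n (pre U) s" and y: "y \<in> U"
  shows "\<exists>m. \<exists>b\<in>forms m. b (rep y) \<noteq> 0 \<and> (\<exists>H. (\<forall>i r. r < d \<longrightarrow> H i r \<in> forms (m + n - k * r)) \<and>
    (\<forall>i. \<forall>p\<in>pre U. s i p * b (rep (bundle_proj p)) = (\<Sum>r<d. H i r (rep (bundle_proj p)) * snd (bundle_rep p) ^ r)))"
proof -
  have yp: "y \<in> plane.points" using U y unfolding zar_plane plane.openin_cone_topology by blast
  then have "rep y \<noteq> 0" using plane.R_in by auto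
  \<comment> \<open>A coordinate that is nonzero at \<open>rep y\<close> is nonzero on the whole
    fibre, and serves as the form of degree one that equalises degrees of denominators.\<close>
  then obtain e where e: "rep y $ e \<noteq> 0" by (auto simp: vec_eq_iff)
  let ?T = "{p \<in> cover. bundle_proj p = y}"
  have "(\<lambda>v::complex^3. v $ e) \<in> forms 1" using forms_linear[of "mat 1" e] by simp
  then have l: "(\<lambda>c. fst c $ e) \<in> S 1" by (rule bundle_forms_pullback[OF k])
  have T: "?T \<subseteq> pre U" using y by (auto simp: pre_def)
  have le: "fst (bundle_rep p) $ e \<noteq> 0" if "p \<in> ?T" for p
    using that e fst_bundle_rep[of p] cover_points by auto
  have "\<exists>m b a. b \<in> S m \<and> (\<forall>p\<in>?T. b (bundle_rep p) \<noteq> 0) \<and> (\<forall>i. a i \<in> S (m + n)) \<and>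
      (\<forall>i. \<forall>q\<in>pre U. s i q * b (bundle_rep q) = a i (bundle_rep q))"
    by (rule total.locfrac_common_denominator[OF s l finite_fibre T]) (rule le)
  then obtain m B A where B: "B \<in> S m" "\<forall>p\<in>?T. B (bundle_rep p) \<noteq> 0"
    and A: "\<forall>i. A i \<in> S (m + n)" "\<forall>i. \<forall>q\<in>pre U. s i q * B (bundle_rep q) = A i (bundle_rep q)"
    by (elim exE conjE)
  obtain C b where C: "C \<in> S (m * (d - 1))" and b: "b \<in> forms (m * d)"
    and BC: "\<And>c. on_cover c \<Longrightarrow> B c * C c = b (fst c)"
    and norm: "\<And>c. on_cover c \<Longrightarrow> b (fst c) = (\<Prod>i<d. B (fst c, root1 d ^ i * snd c))"
    using norm_form[OF B(1)] by blast
  have "A i \<in> S (m + n)" for i using A by blast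
  then have "(\<lambda>c. A i c * C c) \<in> S (m + n + m * (d - 1))" for i by (rule total.mult[OF _ C])
  moreover have "m + n + m * (d - 1) = m * d + n" using d by (cases d) auto
  ultimately have "\<exists>H. (\<forall>r<d. H r \<in> forms (m * d + n - k * r)) \<and>
    (\<forall>c. on_cover c \<longrightarrow> A i c * C c = (\<Sum>r<d. H r (fst c) * snd c ^ r))" for i
    using reduce[of "\<lambda>c. A i c * C c" "m * d + n"] by metis
  then obtain H where H: "\<forall>i. \<forall>r<d. H i r \<in> forms (m * d + n - k * r)"
    "\<forall>i. \<forall>c. on_cover c \<longrightarrow> A i c * C c = (\<Sum>r<d. H i r (fst c) * snd c ^ r)" by metis
  have "b (rep y) \<noteq> 0"
  proof -
    obtain t where t: "t ^ d = f (rep y)"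
    proof (cases "f (rep y) = 0")
      case True
      then show thesis using that[of 0] d by (simp add: zero_power)
    next
      case False
      then have "card {t. t ^ d = f (rep y)} \<noteq> 0" using card_nth_roots[OF False d] d by simp
      then have "{t. t ^ d = f (rep y)} \<noteq> {}" by force
      then show thesis using that by blast
    qed
    have "B (rep y, root1 d ^ i * t) \<noteq> 0" for i
    proof -
      have "(root1 d ^ i) ^ d = 1"
        using root1_power[OF d] by (metis mult.commute power_mult power_one)
      then have "(root1 d ^ i * t) ^ d = f (rep y)" using t by (simp add: power_mult_distrib)
      from fibre_point[OF yp this] obtain p where
        "p \<in> cover" "bundle_proj p = y" "bundle_rep p = (rep y, root1 d ^ i * t)" .
      then show ?thesis using B(2) by force
    qed
    then show ?thesis using norm[of "(rep y, t)"] t by (simp add: on_cover_def)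
  qed
  moreover have "s i p * b (rep (bundle_proj p)) = (\<Sum>r<d. H i r (rep (bundle_proj p)) * snd (bundle_rep p) ^ r)"
    if p: "p \<in> pre U" for i p
  proof -
    have c: "on_cover (bundle_rep p)" and r: "fst (bundle_rep p) = rep (bundle_proj p)"
      using p fst_bundle_rep by (auto simp: pre_def cover_def)
    have "s i p * b (rep (bundle_proj p)) = s i p * B (bundle_rep p) * C (bundle_rep p)"
      using BC[OF c] by (simp add: r)
    also have "\<dots> = A i (bundle_rep p) * C (bundle_rep p)" using A(2) p by simp
    finally show ?thesis using H(2) c by (simp add: r)
  qed
  ultimately show ?thesis using b H(1) by blast
qed

text \<open>Over a denominator \<open>b\<close> from the plane the entries of \<open>s\<close> are
  polynomials in \<open>t\<close>, and \<open>h\<close> consists of their top coefficients.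
  Subtracting the expansion of \<open>h\<close> leaves a solution without top coefficients, which is
  zero off the branch curve. At a branch point \<open>t = 0\<close>, so only constant coefficients
  count, and these agree by density.\<close>

lemma expand_surj_local:
  assumes U: "openin (zar proj_plane) U" and s: "s \<in> sections (pre U)" and y: "y \<in> U"
  shows "\<exists>W h. openin (zar proj_plane) W \<and> y \<in> W \<and> W \<subseteq> U \<and> (\<forall>j<d. plane.locfrac 0 W (\<lambda>_. h j)) \<and>
    (\<forall>i. \<forall>p\<in>pre W. s i p = (\<Sum>j<d. h j (bundle_proj p) * Phi j i (bundle_rep p)))"
proof -
  obtain m b H where b: "b \<in> forms m" "b (rep y) \<noteq> 0"
    and H: "\<And>i r. r < d \<Longrightarrow> H i r \<in> forms (m + N - k * r)"
    and sb: "\<And>i p. p \<in> pre U \<Longrightarrow> s i p * b (rep (bundle_proj p)) =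
      (\<Sum>r<d. H i r (rep (bundle_proj p)) * snd (bundle_rep p) ^ r)"
    using sections_polynomial[OF U sectionsD(4)[OF s] y] by blast
  obtain n g where g: "g \<in> forms n" "g (rep y) \<noteq> 0" "\<forall>q\<in>plane.points. g (rep q) \<noteq> 0 \<longrightarrow> q \<in> U"
    using U y unfolding zar_plane plane.openin_cone_topology by blast
  have yp: "y \<in> plane.points" using U y unfolding zar_plane plane.openin_cone_topology by blast
  have bg: "(\<lambda>v. b v * g v) \<in> forms (m + n)" by (rule forms_mult[OF b(1) g(1)])
  define W where "W = {q \<in> plane.points. b (rep q) * g (rep q) \<noteq> 0}"
  define h where "h = (\<lambda>j q. H j (d - 1) (rep q) / b (rep q))"
  have W: "openin (zar proj_plane) W" unfolding W_def zar_plane by (rule plane.openin_basic[OF bg])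
  have WU: "W \<subseteq> U" using g(3) by (auto simp: W_def)
  \<comment> \<open>Here the twist is decisive: \<open>m + N - k * (d - 1) = m\<close>, so the top
    coefficient has the degree of \<open>b\<close> and their quotient is a function.\<close>
  have Htop: "H j (d - 1) \<in> forms m" for j using H[of "d - 1" j] d by simp
  have reg: "plane.locfrac 0 W (\<lambda>_. h j)" for j
    by (rule plane.locfracI, rule exI[of _ m], rule exI[of _ b], rule exI[of _ "\<lambda>_. H j (d - 1)"])
      (use b Htop in \<open>auto simp: W_def h_def\<close>)
  have off: "b (rep q) \<noteq> 0 \<and> (\<forall>t. (\<Sum>r<d. H i r (rep q) * t ^ r) =
      b (rep q) * (\<Sum>j<d. h j q * Phi j i (rep q, t)))"
    if q: "q \<in> W" "f (rep q) \<noteq> 0" and i: "i < d" for q i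
  proof -
    let ?b = "b (rep q)"
    have bq: "?b \<noteq> 0" and qp: "q \<in> plane.points" using q by (auto simp: W_def)
    have "\<forall>i\<in>{..<d}. \<exists>p. degree p < d \<and> coeff p (d - 1) = h i q \<and>
      (\<forall>t. (\<Sum>j<d. h j q * Phi j i (rep q, t)) = poly p t)"
      using expand_poly[of _ "\<lambda>j. h j q" "rep q"] by simp
    from bchoice[OF this] obtain T where T: "\<And>i. i < d \<Longrightarrow> degree (T i) < d" "\<And>i. i < d \<Longrightarrow> coeff (T i) (d - 1) = h i q"
      "\<And>i t. i < d \<Longrightarrow> (\<Sum>j<d. h j q * Phi j i (rep q, t)) = poly (T i) t"
      by auto
    define Q where "Q i = (\<Sum>r<d. monom (H i r (rep q) / ?b) r)" for i
    \<comment> \<open>The polynomials \<open>T\<close> are chosen only for indices below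
      \<open>d\<close>; reducing indices makes the difference periodic, as the system
      requires.\<close>
    define P where "P i = Q (i mod d) - T (i mod d)" for i
    have Qdeg: "degree (Q i) < d" for i
      unfolding Q_def using d by (intro degree_sum_less) (auto intro: le_less_trans[OF degree_monom_le])
    have Qtop: "coeff (Q i) (d - 1) = h i q" for i
      unfolding Q_def coeff_sum using d by (simp add: h_def)
    have Qpoly: "poly (Q i) t = (\<Sum>r<d. H i r (rep q) * t ^ r) / ?b" for i t
      by (simp add: Q_def poly_sum poly_monom sum_divide_distrib)
    have imod: "i mod d < d" for i using d by simp
    have val: "poly (P i) t = s i p - (\<Sum>j<d. h j q * Phi j i (rep q, t))"
      if p: "p \<in> pre U" "bundle_proj p = q" "bundle_rep p = (rep q, t)" for i t p
    proof -
      have "s (i mod d) = s i" by (rule periodic_mod[of s d]) (rule sectionsD(3)[OF s])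
      moreover have "Phi j (i mod d) = Phi j i" if "j < d" for j
        using that by (intro periodic_mod[of "Phi j" d] Phi_periodic)
      ultimately show ?thesis
        using sb[OF p(1), of "i mod d"] bq T(3)[OF imod[of i], symmetric] p by (simp add: P_def Qpoly field_simps)
    qed
    have "P i = 0" for i
    proof (rule poly_solution_zero[OF _ _ _ q(2)])
      show "degree (P i) < d" for i unfolding P_def using Qdeg T(1)[OF imod] by (rule degree_diff_less)
      show "coeff (P i) (d - 1) = 0" for i using Qtop T(2)[OF imod] by (simp add: P_def)
      show "P (i + d) = P i" for i by (simp add: P_def)
      fix i t assume t: "t ^ d = f (rep q)"
      from fibre_point[OF qp t] obtain p where p: "p \<in> cover" "bundle_proj p = q" "bundle_rep p = (rep q, t)" .
      have pU: "p \<in> pre U" using p q WU by (auto simp: pre_def)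
      have c: "on_cover (rep q, t)" using t by (simp add: on_cover_def)
      have "lam (Suc i) (rep q, t) * (\<Sum>j<d. h j q * Phi j (Suc i) (rep q, t))
        = gam (Suc i) (rep q, t) * (\<Sum>j<d. h j q * Phi j i (rep q, t))"
        unfolding sum_distrib_left using Phi_eq[OF c] by (intro sum.cong) (auto simp: mult.left_commute)
      then show "lam (Suc i) (rep q, t) * poly (P (Suc i)) t = gam (Suc i) (rep q, t) * poly (P i) t"
        using sectionsD(5)[OF s pU, of i] unfolding val[OF pU p(2,3)] p(3) by (simp add: right_diff_distrib)
    qed
    from this[of i] have "Q i = T i" using i by (simp add: P_def)
    then have "(\<Sum>r<d. H i r (rep q) * t ^ r) = ?b * poly (T i) t" for t
      using Qpoly[of i t] bq by (simp add: field_simps)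
    then show ?thesis using T(3)[OF i] bq by simp
  qed
  \<comment> \<open>Multiplied by \<open>b\<close>, the equality of constant coefficients becomes
    one of forms on the plane, to which the density argument applies.\<close>
  have on_zero: "H i 0 (rep q) = (\<Sum>j<d. H j (d - 1) (rep q) * Phi j i (rep q, 0))"
    if q: "q \<in> W" and i: "i < d" for q i
  proof -
    let ?F = "\<lambda>v. H i 0 v - (\<Sum>j<d. H j (d - 1) v * Phi j i (v, 0))"
    have F: "?F \<in> forms (m + N)"
      using H[of 0 i] d by (intro forms.diff forms.sum forms_mult Htop bundle_forms_zero_section[OF k Phi_form]) auto
    have "?F (rep q) = 0"
    proof (rule form_zero_of_zero_off_branch[OF F bg])
      show "b (rep q) * g (rep q) \<noteq> 0" using q by (simp add: W_def)
      fix z assume z: "z \<in> plane.points" "b (rep z) * g (rep z) \<noteq> 0" "f (rep z) \<noteq> 0"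
      then have "z \<in> W" by (simp add: W_def)
      from off[OF this z(3) i] have bz: "b (rep z) \<noteq> 0"
        and "(\<Sum>r<d. H i r (rep z) * 0 ^ r) = b (rep z) * (\<Sum>j<d. h j z * Phi j i (rep z, 0))"
        by (blast, blast)
      moreover have "(\<Sum>r<d. H i r (rep z) * 0 ^ r) = H i 0 (rep z)"
        using sum_power_0[OF d] .
      ultimately show "?F (rep z) = 0" by (simp add: h_def sum_distrib_left)
    qed
    then show ?thesis by simp
  qed
  have main: "s i p = (\<Sum>j<d. h j (bundle_proj p) * Phi j i (bundle_rep p))"
    if p: "p \<in> pre W" and i: "i < d" for i p
  proof -
    define q t where "q = bundle_proj p" and "t = snd (bundle_rep p)"
    have q: "q \<in> W" and pU: "p \<in> pre U" using p WU by (auto simp: pre_def q_def)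
    have r: "bundle_rep p = (rep q, t)" and c: "t ^ d = f (rep q)"
      using p fst_bundle_rep[of p] by (auto simp: pre_def cover_def on_cover_def q_def t_def prod_eq_iff)
    have bq: "b (rep q) \<noteq> 0" using q by (simp add: W_def)
    have "s i p * b (rep q) = (\<Sum>r<d. H i r (rep q) * t ^ r)"
      using sb[OF pU, of i] by (simp add: q_def t_def)
    also have "\<dots> = b (rep q) * (\<Sum>j<d. h j q * Phi j i (rep q, t))"
    proof (cases "f (rep q) = 0")
      case False
      then show ?thesis using off[OF q False i] by blast
    next
      case True
      then have t: "t = 0" using c d by auto
      have "(\<Sum>r<d. H i r (rep q) * t ^ r) = H i 0 (rep q)"
        unfolding t using sum_power_0[OF d] .
      also have "\<dots> = b (rep q) * (\<Sum>j<d. h j q * Phi j i (rep q, t))"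
        using on_zero[OF q i] bq by (simp add: h_def sum_distrib_left t)
      finally show ?thesis .
    qed
    finally show ?thesis using bq by (simp add: r q_def)
  qed
  have "s i p = (\<Sum>j<d. h j (bundle_proj p) * Phi j i (bundle_rep p))" if p: "p \<in> pre W" for i p
  proof -
    have "s (i mod d) = s i" by (rule periodic_mod[of s d]) (rule sectionsD(3)[OF s])
    moreover have "Phi j (i mod d) = Phi j i" if "j < d" for j
      using that by (intro periodic_mod[of "Phi j" d] Phi_periodic)
    ultimately show ?thesis using main[OF p, of "i mod d"] d by simp
  qed
  moreover have "y \<in> W" using yp b g by (simp add: W_def)
  ultimately show ?thesis using W WU reg by blast
qed

text \<open>Local coefficients are unique by \<open>expand_inj\<close>, hence agree on overlaps and
  glue.\<close>

lemma expand_surj: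
  assumes U: "openin (zar proj_plane) U" and s: "s \<in> sections (pre U)"
  shows "\<exists>h\<in>{..<d} \<rightarrow>\<^sub>E reg proj_plane U. expand U h = s"
proof -
  have "\<forall>y\<in>U. \<exists>G. openin (zar proj_plane) (fst G) \<and> y \<in> fst G \<and> fst G \<subseteq> U \<and>
    (\<forall>j<d. plane.locfrac 0 (fst G) (\<lambda>_. snd G j)) \<and>
    (\<forall>i. \<forall>p\<in>pre (fst G). s i p = (\<Sum>j<d. snd G j (bundle_proj p) * Phi j i (bundle_rep p)))"
    using expand_surj_local[OF U s] by simp
  from bchoice[OF this] obtain G where G: "\<forall>y\<in>U. openin (zar proj_plane) (fst (G y)) \<and> y \<in> fst (G y) \<and>
    fst (G y) \<subseteq> U \<and> (\<forall>j<d. plane.locfrac 0 (fst (G y)) (\<lambda>_. snd (G y) j)) \<and>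
    (\<forall>i. \<forall>p\<in>pre (fst (G y)). s i p = (\<Sum>j<d. snd (G y) j (bundle_proj p) * Phi j i (bundle_rep p)))" ..
  define W h where "W y = fst (G y)" and "h y = snd (G y)" for y
  have W: "\<And>y. y \<in> U \<Longrightarrow> openin (zar proj_plane) (W y)" "\<And>y. y \<in> U \<Longrightarrow> y \<in> W y"
      "\<And>y. y \<in> U \<Longrightarrow> W y \<subseteq> U"
    and h: "\<And>y j. y \<in> U \<Longrightarrow> j < d \<Longrightarrow> plane.locfrac 0 (W y) (\<lambda>_. h y j)"
    and sh: "\<And>y i p. y \<in> U \<Longrightarrow> p \<in> pre (W y) \<Longrightarrow>
      s i p = (\<Sum>j<d. h y j (bundle_proj p) * Phi j i (bundle_rep p))"
    using G by (auto simp: W_def h_def)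
  have Up: "U \<subseteq> plane.points" using U unfolding zar_plane plane.openin_cone_topology by blast
  \<comment> \<open>The value at \<open>y\<close> is taken from the solution chosen around
    \<open>y\<close> itself; \<open>agree\<close> compares it with the solutions chosen at nearby
    points.\<close>
  define a where "a = (\<lambda>j\<in>{..<d}. \<lambda>y\<in>U. h y j y)"
  have agree: "h y j z = h z j z" if "y \<in> U" "z \<in> W y" "j < d" for y z j
  proof -
    have z: "z \<in> U" using W that by blast
    let ?V = "W y \<inter> W z"
    have V: "openin (zar proj_plane) ?V" using W that z by blast
    have "expand ?V (h y) = expand ?V (h z)"
      unfolding expand_def
    proof (rule ext, rule restrict_ext)
      fix i p assume "p \<in> pre ?V"
      then have "p \<in> pre (W y)" "p \<in> pre (W z)" by (auto simp: pre_def)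
      then show "(\<Sum>j<d. h y j (bundle_proj p) * Phi j i (bundle_rep p)) =
          (\<Sum>j<d. h z j (bundle_proj p) * Phi j i (bundle_rep p))"
        using sh[OF that(1), of p i] sh[OF z, of p i] by simp
    qed
    moreover have "plane.locfrac 0 ?V (\<lambda>_. h y j)" "plane.locfrac 0 ?V (\<lambda>_. h z j)" if "j < d" for j
      using h[OF \<open>y \<in> U\<close> that] h[OF z that] plane.locfrac_subset by (meson Int_lower1 Int_lower2)+
    ultimately show ?thesis using expand_inj[OF V] that W(2)[OF z] by blast
  qed
  have "plane.locfrac 0 U (\<lambda>_. a j)" if j: "j < d" for j
  proof (rule plane.locfrac_local)
    fix y assume y: "y \<in> U"
    have "plane.locfrac 0 (W y) (\<lambda>_. a j)"
      using h[OF y j] agree[OF y _ j] W(3)[OF y] j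
      by (subst plane.locfrac_cong[of _ _ "\<lambda>_. h y j"]) (auto simp: a_def)
    moreover obtain n g where "g \<in> forms n" "g (rep y) \<noteq> 0" "\<forall>q\<in>plane.points. g (rep q) \<noteq> 0 \<longrightarrow> q \<in> W y"
      using W(1,2)[OF y] unfolding zar_plane plane.openin_cone_topology by blast
    ultimately show "\<exists>V. y \<in> V \<and> V \<subseteq> U \<and> plane.locfrac 0 V (\<lambda>_. a j) \<and>
      (\<exists>n. \<exists>g\<in>forms n. g (rep y) \<noteq> 0 \<and> (\<forall>q\<in>U. g (rep q) \<noteq> 0 \<longrightarrow> q \<in> V))"
      using W[OF y] Up
      by (intro exI[of _ "W y"] exI[of _ n] bexI[of _ g] conjI) (simp_all add: subset_iff)
  qed
  then have "a \<in> {..<d} \<rightarrow>\<^sub>E reg proj_plane U" by (auto simp: a_def reg_plane[OF U])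
  moreover have "expand U a = s"
  proof (intro ext)
    fix i p
    show "expand U a i p = s i p"
    proof (cases "p \<in> pre U")
      case True
      then have y: "bundle_proj p \<in> U" by (simp add: pre_def)
      then have "p \<in> pre (W (bundle_proj p))" using True W(2) by (simp add: pre_def)
      then show ?thesis using sh[OF y] True y by (simp add: expand_def a_def)
    qed (simp add: expand_def sectionsD(2)[OF s])
  qed
  ultimately show ?thesis by blast
qed

lemma direct_image_ulrich_sheaf:
  "isomorphic proj_plane (direct_image cov bundle_proj ulrich_sheaf) (free_sheaf proj_plane d)"
proof (rule isomorphic_over_sym[where \<psi> = expand])
  let ?M = "direct_image cov bundle_proj ulrich_sheaf" and ?N = "free_sheaf proj_plane d"
  have carrier_M: "carrier (sec ?M U) = sections (pre U)" for U
    by (simp add: direct_image_def Let_def ulrich_sheaf_def topspace_cov pre_def)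
  have carrier_N: "carrier (sec ?N U) = {..<d} \<rightarrow>\<^sub>E reg proj_plane U" for U
    by (simp add: free_sheaf_def)
  fix U assume U: "openin (zar proj_plane) U"
  have regD: "plane.locfrac 0 U (\<lambda>_. h j)" "h j \<in> extensional U"
    if "h \<in> carrier (sec ?N U)" "j < d" for h j
    using that PiE_mem[of h "{..<d}" "\<lambda>_. reg proj_plane U" j] by (auto simp: carrier_N reg_plane[OF U])
  have regI: "(\<lambda>y\<in>U. a y) \<in> reg proj_plane U" if "plane.locfrac 0 U (\<lambda>_. a)" for a
    using that plane.locfrac_cong[of U "\<lambda>_. restrict a U" "\<lambda>_. a"] by (simp add: reg_plane[OF U])
  show "bij_betw (expand U) (carrier (sec ?N U)) (carrier (sec ?M U))"
  proof (rule bij_betwI')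
    fix h h' assume h: "h \<in> carrier (sec ?N U)" and h': "h' \<in> carrier (sec ?N U)"
    show "(expand U h = expand U h') = (h = h')"
    proof
      assume eq: "expand U h = expand U h'"
      show "h = h'"
      proof (rule PiE_ext)
        show "h \<in> {..<d} \<rightarrow>\<^sub>E reg proj_plane U" "h' \<in> {..<d} \<rightarrow>\<^sub>E reg proj_plane U"
          using h h' by (auto simp: carrier_N)
        fix j assume "j \<in> {..<d}"
        then have j: "j < d" by simp
        show "h j = h' j"
        proof (rule extensionalityI[OF regD(2)[OF h j] regD(2)[OF h' j]])
          show "h j y = h' j y" if "y \<in> U" for y
            using expand_inj[OF U regD(1)[OF h] regD(1)[OF h'] eq j that] .
        qed
      qed
    qed simp
  next
    show "expand U h \<in> carrier (sec ?M U)" if "h \<in> carrier (sec ?N U)" for h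
      using expand_section[of U h] regD(1)[OF that] by (simp add: carrier_M)
    show "\<exists>h\<in>carrier (sec ?N U). s = expand U h" if "s \<in> carrier (sec ?M U)" for s
      using expand_surj[OF U, of s] that by (auto simp: carrier_M carrier_N)
  qed
  fix h assume h: "h \<in> carrier (sec ?N U)"
  show "h \<oplus>\<^bsub>sec ?N U\<^esub> h' \<in> carrier (sec ?N U) \<and>
      expand U (h \<oplus>\<^bsub>sec ?N U\<^esub> h') = expand U h \<oplus>\<^bsub>sec ?M U\<^esub> expand U h'"
    if h': "h' \<in> carrier (sec ?N U)" for h'
  proof
    show "h \<oplus>\<^bsub>sec ?N U\<^esub> h' \<in> carrier (sec ?N U)"
      using regI[OF plane.locfrac_add[OF regD(1)[OF h] regD(1)[OF h']]]
      by (auto simp: free_sheaf_def reg_ring_def)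
    show "expand U (h \<oplus>\<^bsub>sec ?N U\<^esub> h') = expand U h \<oplus>\<^bsub>sec ?M U\<^esub> expand U h'"
      by (auto simp: free_sheaf_def reg_ring_def direct_image_def Let_def ulrich_sheaf_def topspace_cov
          expand_def fun_eq_iff pre_def distrib_right sum.distrib)
  qed
  show "a \<odot>\<^bsub>sec ?N U\<^esub> h \<in> carrier (sec ?N U) \<and>
      expand U (a \<odot>\<^bsub>sec ?N U\<^esub> h) = a \<odot>\<^bsub>sec ?M U\<^esub> expand U h"
    if a: "a \<in> reg proj_plane U" for a
  proof
    have "plane.locfrac 0 U (\<lambda>_. a)" using a by (simp add: reg_plane[OF U])
    from regI[OF plane.locfrac_scale_function[OF this regD(1)[OF h]]]
    show "a \<odot>\<^bsub>sec ?N U\<^esub> h \<in> carrier (sec ?N U)"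
      by (auto simp: free_sheaf_def reg_ring_def)
    show "expand U (a \<odot>\<^bsub>sec ?N U\<^esub> h) = a \<odot>\<^bsub>sec ?M U\<^esub> expand U h"
      by (auto simp: free_sheaf_def reg_ring_def direct_image_def Let_def ulrich_sheaf_def topspace_cov
          expand_def fun_eq_iff pre_def sum_distrib_left mult.assoc)
  qed
  show "res ?N U V h \<in> carrier (sec ?N V) \<and> expand V (res ?N U V h) = res ?M U V (expand U h)"
    if V: "openin (zar proj_plane) V" "V \<subseteq> U" for V
  proof
    have "restrict (h j) V \<in> reg proj_plane V" if "j < d" for j
      using plane.locfrac_subset[OF regD(1)[OF h that] V(2)]
        plane.locfrac_cong[of V "\<lambda>_. restrict (h j) V" "\<lambda>_. h j"] by (simp add: reg_plane[OF V(1)])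
    then show "res ?N U V h \<in> carrier (sec ?N V)" by (auto simp: free_sheaf_def)
    show "expand V (res ?N U V h) = res ?M U V (expand U h)"
      using V(2) by (auto simp: free_sheaf_def direct_image_def Let_def ulrich_sheaf_def topspace_cov
          expand_def fun_eq_iff pre_def)
  qed
qed

lemma ulrich_bundle_ulrich_sheaf: "ulrich_bundle cov proj_plane bundle_proj d 1 ulrich_sheaf"
  using vector_bundle_ulrich_sheaf direct_image_ulrich_sheaf by (simp add: ulrich_bundle_def)

end

theorem corollary6p3:
  fixes d k :: nat and f :: "complex^3 \<Rightarrow> complex"
  assumes "d > 0" and "k > 0"
    and "f \<in> forms (d * k)"
    and "fermat_curve (d * k) (zero_locus plane_cone (*s) f)"
  shows "\<exists>E :: ((complex^3) \<times> complex) set fun_sheaf.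
    ulrich_bundle (cyclic_cover d k f) proj_plane bundle_proj d 1 E"
proof -
  have n: "d * k > 0" using assms by simp
  obtain A :: "complex^3^3" and c where A: "invertible A" and c: "c \<noteq> 0"
    and f: "\<And>v. f v = c * ((A *v v)$1 ^ (d * k) + (A *v v)$2 ^ (d * k) - (A *v v)$3 ^ (d * k))"
    using fermat_form[OF n assms(3,4)] by blast
  have "card {z. z ^ d = c} \<noteq> 0" using card_nth_roots[OF c assms(1)] assms(1) by simp
  then have "{z. z ^ d = c} \<noteq> {}" by force
  then obtain e where e: "e ^ d = c" by blast
  \<comment> \<open>A \<open>d\<close>-th root \<open>e\<close> of the constant \<open>c\<close> is
    absorbed into the forms, so that their \<open>d\<close>-th powers are \<open>c\<close> times the
    terms of the Fermat form.\<close>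
  define L where "L i v = e * (A *v v)$i ^ k" for i v
  have L: "L i \<in> forms k" for i
    using forms.scale[OF forms.pow[OF forms_linear[of A i], of k], of e] by (simp add: L_def[abs_def])
  have Ld: "L i v ^ d = c * (A *v v)$i ^ (d * k)" for i v
    by (simp add: L_def power_mult_distrib e mult.commute flip: power_mult)
  obtain B where B: "A ** B = mat 1" "B ** A = mat 1" using A by (auto simp: invertible_def)
  have "fermat_cover d k (L 1) (L 2) (L 3) f"
  proof
    show "f v = L 1 v ^ d + L 2 v ^ d - L 3 v ^ d" for v by (simp add: f Ld algebra_simps)
    show "L 3 v \<noteq> 0" if "v \<noteq> 0" "L 1 v = 0" "L 2 v = 0" for v
    proof
      assume "L 3 v = 0"
      have "e \<noteq> 0" using c e assms(1) by auto
      then have "A *v v = 0"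
        using \<open>L 3 v = 0\<close> that assms(2) by (auto simp: L_def vec_eq_iff forall_3)
      then have "B *v (A *v v) = 0" by simp
      then show False using \<open>v \<noteq> 0\<close> by (simp add: matrix_vector_mul_assoc B)
    qed
    \<comment> \<open>A point off the branch curve: in the new coordinates it is
      \<open>[1, 0, 0]\<close>, where the Fermat form has value 1.\<close>
    have "A *v (B *v vector [1, 0, 0]) = vector [1, 0, 0]" by (simp add: matrix_vector_mul_assoc B)
    then have "f (B *v vector [1, 0, 0]) \<noteq> 0" using c n by (simp add: f zero_power)
    then show "\<exists>v. f v \<noteq> 0" by blast
  qed (use assms L in auto)
  then show ?thesis by (blast intro: fermat_cover.ulrich_bundle_ulrich_sheaf)
qed

end
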